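(* Let $n,m\in\mathbb{N}_0$ with $n\ge m$, let $\nu\in\mathbb{C}\setminus\{2m,2m+2,2m+4,\dots\}$, let $r,r'\in(0,\infty)$ with $r\ne r'$, and let $\theta'\in(0,\pi)$. Then \[ \int_0^\pi (\chi^2-1)^{(\nu+1)/4}\,Q^{-(\nu+1)/2}_{m-1/2}(\chi)\,\mathrm{P}^m_n(\cos\theta)\,(\sin\theta)^{(\nu+2)/2}\,d\theta =\frac{i\sqrt{\pi}}{2^{(\nu+1)/2}(\sin\theta')^{\nu/2}}\left(\frac{r_>^2-r_<^2}{rr'}\right)^{(\nu+2)/2} Q_n^{-(\nu+2)/2}\!\left(\frac{r^2+r'^2}{2rr'}\right)\mathrm{P}^m_n(\cos\theta'), \] where $\chi=\dfrac{r^2+r'^2-2rr'\cos\theta\cos\theta'}{2rr'\sin\theta\sin\theta'}$ and $r_<=\min\{r,r'\}$, $r_>=\max\{r,r'\}$.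
   Context: For $z\in\mathbb{C}\setminus(-\infty,1]$, $Q^\mu_\nu(z)=e^{\mu\pi i}\frac{\sqrt{\pi}\,\Gamma(\nu+\mu+1)(z^2-1)^{\mu/2}}{2^{\nu+1}z^{\nu+\mu+1}}\,\mathbf{F}\!\left(\frac{\nu+\mu}{2}+1,\frac{\nu+\mu+1}{2};\nu+\frac32;\frac{1}{z^2}\right)$ is the associated Legendre function of the second kind, with $\mathbf{F}(a,b;c;x)={}_2F_1(a,b;c;x)/\Gamma(c)$ and principal branches. $\mathrm{P}^\mu_\nu$ is the Ferrers function of the first kind: for $x\in(-1,1)$, $\mathrm{P}^\mu_\nu(x)=\left(\frac{1+x}{1-x}\right)^{\mu/2}\mathbf{F}\!\left(\nu+1,-\nu;1-\mu;\frac{1-x}{2}\right)$; for integers $0\le m\le n$ this equals $(-1)^m(1-x^2)^{m/2}\frac{d^m}{dx^m}P_n(x)$ with $P_n$ the Legendre polynomial. All non-integer powers of positive reals are the positive ones. *)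

theory Defs
  imports "HOL-Analysis.Analysis"
begin

text \<open>Regularized Gauss hypergeometric function
  F(a,b;c;x) = 2F1(a,b;c;x)/Gamma(c) = sum_k (a)_k (b)_k / (Gamma(c+k) k!) x^k,
  given by its power series (used only for |x| < 1).\<close>
definition hyperF :: "complex \<Rightarrow> complex \<Rightarrow> complex \<Rightarrow> complex \<Rightarrow> complex" where
  "hyperF a b c x =
     (\<Sum>k. pochhammer a k * pochhammer b k * rGamma (c + of_nat k) / fact k * x ^ k)"

definition LegendreQ :: "complex \<Rightarrow> complex \<Rightarrow> complex \<Rightarrow> complex" where
  "LegendreQ mu nu z =
     exp (mu * of_real pi * \<i>) * of_real (sqrt pi) * Gamma (nu + mu + 1)
       * (z\<^sup>2 - 1) powr (mu / 2)
       / (2 powr (nu + 1) * z powr (nu + mu + 1))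
       * hyperF ((nu + mu) / 2 + 1) ((nu + mu + 1) / 2) (nu + 3 / 2) (1 / z\<^sup>2)"

definition FerrersP :: "complex \<Rightarrow> complex \<Rightarrow> real \<Rightarrow> complex" where
  "FerrersP mu nu x =
     complex_of_real ((1 + x) / (1 - x)) powr (mu / 2)
       * hyperF (nu + 1) (- nu) (1 - mu) (complex_of_real ((1 - x) / 2))"

end

theory Submission
  imports Defs "HOL-Computational_Algebra.Polynomial"
begin

text \<open>
  With s = - \<nu> / 2 and z = (r^2 + r'^2) / (2 r r'), the left-hand kernel is, up to elementary factors, the
  m-th Fourier coefficient in \<phi> of \<Gamma>(s) (z - cos \<gamma>) powr (- s), where
  cos \<gamma> = cos \<theta> cos \<theta>' + sin \<theta> sin \<theta>' cos \<phi>, so the identity is an instance of the Funk--Hecke theorem.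
  Expanding the kernel in powers of cos \<gamma> kills the powers below m, so only the values \<Gamma>(s + k) with
  k \<ge> m occur; this covers all admissible \<nu> at once, including those for which \<Gamma>(s) has a pole.

  For a single power of cos \<gamma> the Fourier coefficient divided by (sin \<theta> sin \<theta>') ^ m is a polynomial in
  cos \<theta> and cos \<theta>' on which the Gegenbauer operator (1 - x^2) d^2 - 2 (m + 1) x d acts in the same way
  in either variable. The operator is self-adjoint for the weight (1 - x^2) ^ m and its polynomial eigenfunctions
  are determined by their value at 1, so integration against the Ferrers function reproduces it up
  to a factor. That factor satisfies a two-term recursion in the exponent, and summing the series gives Q on the right.
\<close>

section \<open>The Gegenbauer operator\<close>

text \<open>This is the associated Legendre operator after conjugation with (1 - x^2)^(m/2), up to
  the additive constant m (m + 1). The conjugation removes the singular term m^2 / (1 - x^2), so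
  polynomials are sent to polynomials.\<close>

definition gegenbauer_op :: "nat \<Rightarrow> real poly \<Rightarrow> real poly" where
  "gegenbauer_op m p =
     [:1, 0, -1:] * pderiv (pderiv p) - smult (2 * (real m + 1)) ([:0, 1:] * pderiv p)"

lemma gegenbauer_op_diff: "gegenbauer_op m (p - q) = gegenbauer_op m p - gegenbauer_op m q"
  by (simp add: gegenbauer_op_def pderiv_diff algebra_simps smult_diff_right)

lemma gegenbauer_op_smult: "gegenbauer_op m (smult c p) = smult c (gegenbauer_op m p)"
  by (rule poly_eq_poly_eq_iff[THEN iffD1], rule ext)
     (simp add: gegenbauer_op_def pderiv_smult algebra_simps)

lemma gegenbauer_op_add: "gegenbauer_op m (p + q) = gegenbauer_op m p + gegenbauer_op m q"
  by (simp add: gegenbauer_op_def pderiv_add algebra_simps smult_add_right)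

lemma gegenbauer_op_sum: "gegenbauer_op m (\<Sum>i\<in>A. f i) = (\<Sum>i\<in>A. gegenbauer_op m (f i))"
  by (induction A rule: infinite_finite_induct)
     (simp_all add: gegenbauer_op_add, simp_all add: gegenbauer_op_def)

text \<open>Differentiating the eigenvalue equation raises m by one; evaluating it at 1 then makes all derivatives at 1 vanish.\<close>
lemma gegenbauer_op_eigen_unique:
  assumes "gegenbauer_op m g = smult c g" and "poly g 1 = 0"
  shows "g = 0"
  using assms
proof (induction "degree g" arbitrary: g m c rule: less_induct)
  case less
  have ev: "poly (gegenbauer_op m g) 1 = c * poly g 1"
    using less.prems by simp
  \<comment> \<open>The coefficient of the second derivative vanishes at 1, leaving -2 (m + 1) g'(1)
    = c g(1) = 0.\<close>
  hence d1: "poly (pderiv g) 1 = 0"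
    using less.prems(2) by (simp add: gegenbauer_op_def)
  show ?case
  proof (cases "degree g = 0")
    case True
    then obtain a where "g = [:a:]" by (rule degree_eq_zeroE)
    then show ?thesis using less.prems(2) by simp
  next
    case False
    have "pderiv (gegenbauer_op m g) = smult c (pderiv g)"
      using less.prems(1) by (simp add: pderiv_smult)
    moreover have "pderiv (gegenbauer_op m g) =
        gegenbauer_op (Suc m) (pderiv g) - smult (2 * (real m + 1)) (pderiv g)"
      by (rule poly_eq_poly_eq_iff[THEN iffD1], rule ext)
         (simp add: gegenbauer_op_def pderiv_diff pderiv_mult pderiv_smult pderiv_pCons algebra_simps
           del: mult_pCons_left mult_pCons_right)
    ultimately have "gegenbauer_op (Suc m) (pderiv g) = smult (c + 2 * (real m + 1)) (pderiv g)"
      by (simp add: smult_add_left diff_eq_eq)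
    moreover have "degree (pderiv g) < degree g"
      using False by (simp add: degree_pderiv)
    ultimately have "pderiv g = 0"
      using less.hyps d1 by blast
    then show ?thesis
      using False by (simp add: pderiv_eq_0_iff)
  qed
qed

section \<open>Integration in the variable x = cos t and self-adjointness\<close>

text \<open>The integral of \<open>p\<close> over [-1, 1] after the substitution x = cos t. In this
  form it matches the integral over theta, and no change of variables has to be carried out.\<close>

definition cos_integral :: "real poly \<Rightarrow> real" where
  "cos_integral p = integral {0..pi} (\<lambda>t. poly p (cos t) * sin t)"

lemma cos_integral_has: "((\<lambda>t. poly p (cos t) * sin t) has_integral cos_integral p) {0..pi}"
  unfolding cos_integral_def
  by (intro integrable_integral integrable_continuous_real continuous_intros)

lemma cos_integral_add: "cos_integral (p + q) = cos_integral p + cos_integral q"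
  using has_integral_add[OF cos_integral_has cos_integral_has, of p q]
  by (intro has_integral_unique[OF cos_integral_has]) (simp add: algebra_simps)

lemma cos_integral_smult: "cos_integral (smult c p) = c * cos_integral p"
  using has_integral_mult_right[OF cos_integral_has, of c p]
  by (intro has_integral_unique[OF cos_integral_has]) (simp add: algebra_simps)

lemma cos_integral_diff: "cos_integral (p - q) = cos_integral p - cos_integral q"
  using cos_integral_add[of p "smult (-1) q"] cos_integral_smult[of "-1" q] by simp

lemma cos_integral_pderiv: "cos_integral (pderiv p) = poly p 1 - poly p (- 1)"
proof -
  have "((\<lambda>t. poly (pderiv p) (cos t) * sin t) has_integral
          (- poly p (cos pi)) - (- poly p (cos 0))) {0..pi}"
    by (rule fundamental_theorem_of_calculus)
       (auto intro!: derivative_eq_intros simp: has_real_derivative_iff_has_vector_derivative[symmetric])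
  then show ?thesis
    using has_integral_unique[OF cos_integral_has] by fastforce
qed

text \<open>Sturm--Liouville form: the first-order term is produced by the derivative -2 (m + 1) x
  (1 - x^2)^m of (1 - x^2)^(m + 1).\<close>

lemma gegenbauer_op_divergence:
  "[:1, 0, -1:] ^ m * gegenbauer_op m p = pderiv ([:1, 0, -1:] ^ Suc m * pderiv p)"
  by (rule poly_eq_poly_eq_iff[THEN iffD1], rule ext)
     (simp add: gegenbauer_op_def pderiv_mult pderiv_power_Suc pderiv_pCons algebra_simps
        del: power_Suc, simp add: algebra_simps)

text \<open>The boundary terms vanish because (1 - x^2)^(m + 1) is zero at both endpoints. The
  right-hand side is symmetric in \<open>p\<close> and \<open>q\<close>, which is the source of
  self-adjointness.\<close>

lemma gegenbauer_op_by_parts: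
  "cos_integral ([:1, 0, -1:] ^ m * gegenbauer_op m p * q)
     = - cos_integral ([:1, 0, -1:] ^ Suc m * pderiv p * pderiv q)"
proof -
  let ?h = "[:1, 0, -1:] ^ Suc m * pderiv p :: real poly"
  have "cos_integral (pderiv (?h * q)) = 0"
    by (subst cos_integral_pderiv) simp
  moreover have "pderiv (?h * q) = pderiv ?h * q + ?h * pderiv q"
    by (simp only: pderiv_mult[of ?h q]) (simp only: ac_simps)
  ultimately show ?thesis
    by (simp only: gegenbauer_op_divergence cos_integral_add)
qed

lemma gegenbauer_op_selfadjoint:
  "cos_integral ([:1, 0, -1:] ^ m * gegenbauer_op m p * q)
     = cos_integral ([:1, 0, -1:] ^ m * p * gegenbauer_op m q)"
proof -
  have "[:1, 0, -1:] ^ m * p * gegenbauer_op m q = [:1, 0, -1:] ^ m * gegenbauer_op m q * p"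
    "[:1, 0, -1:] ^ Suc m * pderiv p * pderiv q = [:1, 0, -1:] ^ Suc m * pderiv q * pderiv p"
    by (simp_all only: ac_simps)
  then show ?thesis
    by (simp only: gegenbauer_op_by_parts)
qed

text \<open>A Beta integral. The polynomial x (1 - x^2)^(n + 1) vanishes at both endpoints and its
  derivative combines the powers n and n + 1 of 1 - x^2; integrating it gives the recursion.\<close>

lemma cos_integral_sin_power:
  "cos_integral ([:1, 0, -1:] ^ n) * Gamma (real n + 3 / 2) = sqrt pi * fact n"
proof (induction n)
  case 0
  have "cos_integral (pderiv [:0, 1:]) = 2"
    by (subst cos_integral_pderiv) simp
  then have "cos_integral [:1:] = 2" by (simp add: pderiv_pCons)
  moreover have "Gamma (3 / 2 :: real) = sqrt pi / 2"
    using Gamma_plus1[of "1/2 :: real"] nonpos_Ints_nonpos[of "1/2 :: real"]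
    by (force simp: Gamma_one_half_real)
  ultimately show ?case by (simp add: one_pCons)
next
  case (Suc n)
  let ?w = "[:1, 0, -1:] :: real poly"
  have "cos_integral (pderiv ([:0, 1:] * ?w ^ Suc n)) = 0"
    by (subst cos_integral_pderiv) simp
  moreover have "pderiv ([:0, 1:] * ?w ^ Suc n) =
      smult (2 * real n + 3) (?w ^ Suc n) - smult (2 * real n + 2) (?w ^ n)"
    by (rule poly_eq_poly_eq_iff[THEN iffD1], rule ext)
      (simp add: pderiv_mult pderiv_power_Suc pderiv_pCons algebra_simps
         del: mult_pCons_left mult_pCons_right power_Suc, simp add: algebra_simps)
  ultimately have *: "(2 * real n + 3) * cos_integral (?w ^ Suc n)
      = (2 * real n + 2) * cos_integral (?w ^ n)"
    by (simp add: cos_integral_diff cos_integral_smult)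
  have "Gamma (real (Suc n) + 3 / 2) = (real n + 3 / 2) * Gamma (real n + 3 / 2)"
    using Gamma_plus1[of "real n + 3 / 2"] nonpos_Ints_nonpos[of "real n + 3 / 2"]
    by (force simp: algebra_simps)
  then have "cos_integral (?w ^ Suc n) * Gamma (real (Suc n) + 3 / 2)
      = ((2 * real n + 3) * cos_integral (?w ^ Suc n)) / 2 * Gamma (real n + 3 / 2)"
    by (simp add: algebra_simps)
  also have "\<dots> = (real n + 1) * (cos_integral (?w ^ n) * Gamma (real n + 3 / 2))"
    by (simp only: *) (simp add: algebra_simps)
  finally show ?case using Suc by (simp add: algebra_simps)
qed

section \<open>The polynomial factor of the Ferrers function\<close>

text \<open>In the regularized series of the Ferrers function the terms of index k < m vanish,
  because 1/Gamma(1 - m + k) does. The index \<open>i\<close> counts from k = m on.\<close>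

definition ferrers_coeff :: "nat \<Rightarrow> nat \<Rightarrow> nat \<Rightarrow> real" where
  "ferrers_coeff n m i = pochhammer (real n + 1) (m + i) * pochhammer (- real n) (m + i)
     / (fact i * fact (m + i))"

text \<open>This is (-2)^m times the m-th derivative of the Legendre polynomial P_n. The sum runs to
  \<open>n\<close> for every \<open>m\<close>, coefficients with m + i > n being zero, so that sums
  for different \<open>m\<close> can be compared termwise.\<close>

definition ferrers_poly :: "nat \<Rightarrow> nat \<Rightarrow> real poly" where
  "ferrers_poly n m = (\<Sum>i\<le>n. smult (ferrers_coeff n m i) ([:1/2, - (1/2):] ^ i))"

lemma ferrers_coeff_eq_0: "n < m + i \<Longrightarrow> ferrers_coeff n m i = 0"
  by (simp add: ferrers_coeff_def pochhammer_of_nat_eq_0_iff)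

lemma ferrers_coeff_rec:
  "(real i + 1) * (real i + 1 + real m) * ferrers_coeff n m (Suc i)
     = (real n + 1 + real m + real i) * (real m + real i - real n) * ferrers_coeff n m i"
  by (simp add: ferrers_coeff_def pochhammer_Suc divide_simps) (simp add: algebra_simps)

text \<open>In the variable u = (1 - x)/2 the operator becomes the hypergeometric operator u (1 - u)
  d^2 + (m + 1) (1 - 2 u) d. For i = 0 the truncated exponent comes with coefficient 0.\<close>

lemma gegenbauer_op_half_power:
  "gegenbauer_op m ([:1/2, - (1/2):] ^ i)
     = smult (real i * (real i + real m)) ([:1/2, - (1/2):] ^ (i - 1))
       - smult (real i * (real i + 2 * real m + 1)) ([:1/2, - (1/2):] ^ i)"
proof (cases i)
  case 0
  then show ?thesis by (simp add: gegenbauer_op_def)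
next
  case (Suc j)
  let ?u = "[:1/2, - (1/2):] :: real poly"
  have d1: "pderiv (?u ^ i) = smult (- real i / 2) (?u ^ j)"
    unfolding Suc
    by (intro poly_eq_poly_eq_iff[THEN iffD1] ext)
       (simp add: pderiv_power_Suc pderiv_pCons field_simps del: power_Suc)
  show ?thesis
  proof (cases j)
    case 0
    then show ?thesis
      unfolding gegenbauer_op_def d1 unfolding Suc
      by (intro poly_eq_poly_eq_iff[THEN iffD1] ext) (simp add: field_simps)
  next
    case j: (Suc k)
    have d2: "pderiv (pderiv (?u ^ i)) = smult (real i * real j / 4) (?u ^ k)"
      unfolding d1 j
      by (intro poly_eq_poly_eq_iff[THEN iffD1] ext)
         (simp add: pderiv_minus pderiv_smult pderiv_power_Suc pderiv_pCons field_simps del: power_Suc)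
    have identity: "(1 - x * x) * (i * j / 4) * u ^ k - 2 * (m' + 1) * x * (- i / 2) * u ^ Suc k =
        i * (i + m') * u ^ Suc k - i * (i + 2 * m' + 1) * u ^ Suc (Suc k)"
      if "x = 1 - 2 * u" "i = j + 1" for x u i j m' :: real
      unfolding that by (simp add: field_simps)
    show ?thesis
    proof (rule poly_eq_poly_eq_iff[THEN iffD1], rule ext)
      fix x :: real
      define u where "u = poly ?u x"
      have "x = 1 - 2 * u" by (simp add: u_def field_simps)
      from identity[OF this, of "real i" "real j" "real m"] Suc
      have "(1 - x * x) * (real i * real j / 4 * u ^ k) - 2 * (real m + 1) * (x * (- real i / 2 * u ^ j)) =
        real i * (real i + real m) * u ^ (i - 1) - real i * (real i + 2 * real m + 1) * u ^ i"
        by (simp add: j mult_ac del: power_Suc)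
      moreover have "poly [:1, 0, -1:] x = 1 - x * x" "poly [:0, 1:] x = x" by simp_all
      ultimately show "poly (gegenbauer_op m (?u ^ i)) x =
          poly (smult (real i * (real i + real m)) (?u ^ (i - 1))
            - smult (real i * (real i + 2 * real m + 1)) (?u ^ i)) x"
        unfolding gegenbauer_op_def d2 unfolding d1
        by (simp only: poly_diff poly_mult poly_smult poly_power u_def[symmetric])
    qed
  qed
qed

text \<open>Comparing coefficients of powers of (1 - x)/2 turns the eigenvalue equation into the
  two-term relation \<open>ferrers_coeff_rec\<close>.\<close>

lemma ferrers_poly_eigen:
  "gegenbauer_op m (ferrers_poly n m)
     = smult (- ((real n - real m) * (real n + real m + 1))) (ferrers_poly n m)"
proof (rule poly_eq_poly_eq_iff[THEN iffD1], rule ext)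
  fix x :: real
  let ?a = "ferrers_coeff n m" and ?u = "(1 - x) / 2"
  have "poly (gegenbauer_op m (ferrers_poly n m)) x =
      (\<Sum>i\<le>n. ?a i * (real i * (real i + real m)) * ?u ^ (i - 1))
      - (\<Sum>i\<le>n. ?a i * (real i * (real i + 2 * real m + 1)) * ?u ^ i)"
    by (simp add: ferrers_poly_def gegenbauer_op_sum gegenbauer_op_smult gegenbauer_op_half_power
        poly_sum diff_divide_distrib sum_subtractf right_diff_distrib mult.assoc)
  \<comment> \<open>Adding the vanishing coefficient of index n + 1 makes the range {..n} reappear
    after the index shift.\<close>
  also have "(\<Sum>i\<le>n. ?a i * (real i * (real i + real m)) * ?u ^ (i - 1))
      = (\<Sum>i\<le>Suc n. ?a i * (real i * (real i + real m)) * ?u ^ (i - 1))"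
    by (simp add: ferrers_coeff_eq_0)
  also have "\<dots> = (\<Sum>i\<le>n. ((real i + 1) * (real i + 1 + real m) * ?a (Suc i)) * ?u ^ i)"
    by (subst sum.atMost_Suc_shift) (simp add: mult_ac add_ac)
  also have "\<dots> = (\<Sum>i\<le>n. (real n + 1 + real m + real i) * (real m + real i - real n) * ?a i * ?u ^ i)"
    by (simp only: ferrers_coeff_rec)
  also have "\<dots> - (\<Sum>i\<le>n. ?a i * (real i * (real i + 2 * real m + 1)) * ?u ^ i)
      = (\<Sum>i\<le>n. - ((real n - real m) * (real n + real m + 1)) * (?a i * ?u ^ i))"
    by (subst sum_subtractf[symmetric], rule sum.cong) (simp_all add: algebra_simps)
  also have "\<dots> = poly (smult (- ((real n - real m) * (real n + real m + 1))) (ferrers_poly n m)) x"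
    by (simp add: ferrers_poly_def poly_sum sum_distrib_left sum_negf diff_divide_distrib)
  finally show "poly (gegenbauer_op m (ferrers_poly n m)) x = \<dots>" .
qed

lemma pderiv_ferrers_poly: "pderiv (ferrers_poly n m) = smult (-1/2) (ferrers_poly n (Suc m))"
proof -
  have "pderiv (ferrers_poly n m)
      = (\<Sum>i\<le>n. smult (ferrers_coeff n m i) (pderiv ([:1/2, - (1/2):] ^ i)))"
    by (simp add: ferrers_poly_def pderiv_smult higher_pderiv_sum[of 1, simplified])
  also have "\<dots> = (\<Sum>i\<le>Suc n. smult (ferrers_coeff n m i) (pderiv ([:1/2, - (1/2):] ^ i)))"
    by (simp add: ferrers_coeff_eq_0)
  also have "\<dots> = (\<Sum>i\<le>n. smult (ferrers_coeff n m (Suc i)) (pderiv ([:1/2, - (1/2):] ^ Suc i)))"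
    by (subst sum.atMost_Suc_shift) simp
  also have "\<dots> = (\<Sum>i\<le>n. smult (-1/2) (smult (ferrers_coeff n (Suc m) i) ([:1/2, - (1/2):] ^ i)))"
    by (intro sum.cong refl poly_eq_poly_eq_iff[THEN iffD1] ext)
       (simp add: pderiv_power_Suc pderiv_pCons ferrers_coeff_def divide_simps del: power_Suc)
  finally show ?thesis
    by (intro poly_eq_poly_eq_iff[THEN iffD1] ext)
       (simp add: ferrers_poly_def poly_sum sum_distrib_left sum_negf)
qed

lemma poly_ferrers_poly_1:
  assumes "m \<le> n"
  shows "poly (ferrers_poly n m) 1 = (-1) ^ m * fact (n + m) / (fact m * fact (n - m))"
proof -
  have "poly (ferrers_poly n m) 1 = (\<Sum>i\<le>n. if i = 0 then ferrers_coeff n m 0 else 0)"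
    unfolding ferrers_poly_def poly_sum by (intro sum.cong) auto
  also have "\<dots> = pochhammer (real n + 1) m * pochhammer (- real n) m / fact m"
    by (simp add: ferrers_coeff_def)
  also have "pochhammer (- real n) m = (-1) ^ m * (fact n / fact (n - m))"
  proof -
    have "fact n = fact (n - m) * pochhammer (1 + real (n - m)) m"
      using pochhammer_product'[of "1::real" "n - m" m] assms by (simp add: pochhammer_fact)
    then show ?thesis
      using assms by (simp add: pochhammer_minus of_nat_diff add_ac)
  qed
  also have "pochhammer (real n + 1) m = fact (n + m) / fact n"
    using pochhammer_product'[of "1::real" n m] by (simp add: pochhammer_fact[symmetric] add_ac divide_simps)
  finally show ?thesis by (simp add: field_simps)
qed

text \<open>Raising m past n gives the zero polynomial, so the derivative vanishes and the value at
  1 determines the constant.\<close>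

lemma ferrers_poly_same: "ferrers_poly n n = [:(-1) ^ n * fact (2 * n) / fact n:]"
proof -
  have "pderiv (ferrers_poly n n) = 0"
    by (simp add: pderiv_ferrers_poly) (simp add: ferrers_poly_def ferrers_coeff_eq_0)
  then obtain a where a: "ferrers_poly n n = [:a:]"
    by (auto simp: pderiv_eq_0_iff elim: degree_eq_zeroE)
  then show ?thesis
    using poly_ferrers_poly_1[of n n] by (simp add: mult_2)
qed

section \<open>The Funk--Hecke formula for powers\<close>

text \<open>These are the functions of one variable that remain in the Fourier coefficient of (cos
  \<gamma>)^(m + N) once (sin \<theta> sin \<theta>')^m is divided out: even powers of the sine
  times the remaining power of the cosine.\<close>

definition sphere_basis :: "nat \<Rightarrow> nat \<Rightarrow> real poly" where
  "sphere_basis N j = [:1, 0, -1:] ^ j * [:0, 1:] ^ (N - 2 * j)"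

text \<open>The operator acts on this family as a tridiagonal matrix. Truncated subtraction is
  harmless: the lowering coefficient is 0 for j = 0, and the raising one is 0 when N - 2 j is 0 or
  1.\<close>

lemma gegenbauer_op_sphere_basis:
  assumes "2 * j \<le> N"
  shows "gegenbauer_op m (sphere_basis N j) =
     smult (4 * real j * (real j + real m)) (sphere_basis N (j - 1))
     + smult (real (N - 2 * j) * (real (N - 2 * j) - 1)) (sphere_basis N (Suc j))
     - smult (2 * real j * (2 * real (N - 2 * j) + 1) + 2 * (real m + 1) * real (N - 2 * j))
         (sphere_basis N j)"
proof (rule poly_eq_poly_eq_iff[THEN iffD1], rule ext)
  fix x :: real
  define l where "l = N - 2 * j"
  let ?W = "[:1, 0, -1:] ^ j :: real poly" and ?Y = "[:0, 1:] ^ l :: real poly"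
  have dW: "pderiv ([:1, 0, -1:] ^ i) = smult (- 2 * real i) ([:0, 1:] * [:1, 0, -1:] ^ (i - 1))"
    for i :: nat
    by (rule poly_eq_poly_eq_iff[THEN iffD1], rule ext)
       (simp add: pderiv_power pderiv_pCons algebra_simps)
  have dY: "pderiv ([:0, 1:] ^ i) = smult (real i) ([:0, 1:] ^ (i - 1) :: real poly)" for i :: nat
    by (simp add: pderiv_power pderiv_pCons)
  \<comment> \<open>The equation (1 - x^2) W' = -2 j x W for W = (1 - x^2)^j and its derivative
    express the second-order term through x W' and W, so that the exponent j - 2 never
    occurs.\<close>
  have wW1: "[:1, 0, -1:] * pderiv ?W = smult (- 2 * real j) ([:0, 1:] * ?W)"
    unfolding dW by (rule poly_eq_poly_eq_iff[THEN iffD1], rule ext) (cases j; simp add: algebra_simps)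
  have "pderiv ([:1, 0, -1:] * pderiv ?W) = pderiv (smult (- 2 * real j) ([:0, 1:] * ?W))"
    by (simp only: wW1)
  then have wW2: "(1 - x * x) * poly (pderiv (pderiv ?W)) x
      = (2 - 2 * real j) * x * poly (pderiv ?W) x - 2 * real j * (1 - x * x) ^ j"
    unfolding pderiv_mult pderiv_smult
    by (drule_tac arg_cong[where f = "\<lambda>p. poly p x"]) (simp add: pderiv_pCons algebra_simps
        del: mult_pCons_left mult_pCons_right)
  have W1: "(1 - x * x) * poly (pderiv ?W) x = - 2 * real j * x * (1 - x * x) ^ j"
    using arg_cong[OF wW1, of "\<lambda>p. poly p x"] by (simp add: algebra_simps)
  have xW1: "x * poly (pderiv ?W) x = - 2 * real j * x\<^sup>2 * (1 - x * x) ^ (j - 1)"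
    by (simp add: dW power2_eq_square algebra_simps)
  have Y1: "x * poly (pderiv ?Y) x = real l * x ^ l"
    unfolding dY by (cases l) simp_all
  have Y2: "poly (pderiv (pderiv ?Y)) x = real l * (real l - 1) * x ^ (l - 2)"
    unfolding dY pderiv_smult by (cases l) (simp_all add: numeral_2_eq_2)
  have up: "real j * (x\<^sup>2 * (1 - x * x) ^ (j - 1) * x ^ l) = real j * poly (sphere_basis N (j - 1)) x"
  proof (cases j)
    case (Suc i)
    then have "N - 2 * i = Suc (Suc l)" using assms by (simp add: l_def)
    with Suc show ?thesis by (simp add: sphere_basis_def power2_eq_square algebra_simps)
  qed simp
  have down: "(1 - x * x) * (1 - x * x) ^ j * x ^ (l - 2) = poly (sphere_basis N (Suc j)) x"
    by (simp add: sphere_basis_def l_def algebra_simps)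
  have id: "poly (sphere_basis N j) x = (1 - x * x) ^ j * x ^ l"
    by (simp add: sphere_basis_def l_def)
  have "poly (gegenbauer_op m (sphere_basis N j)) x =
      ((1 - x * x) * poly (pderiv (pderiv ?W)) x) * x ^ l
      + 2 * ((1 - x * x) * poly (pderiv ?W) x) * poly (pderiv ?Y) x
      + (1 - x * x) * (1 - x * x) ^ j * poly (pderiv (pderiv ?Y)) x
      - 2 * (real m + 1) * ((x * poly (pderiv ?W) x) * x ^ l
          + (1 - x * x) ^ j * (x * poly (pderiv ?Y) x))"
    unfolding gegenbauer_op_def sphere_basis_def l_def[symmetric]
    by (simp add: pderiv_mult pderiv_add algebra_simps del: mult_pCons_left mult_pCons_right)
  also have "\<dots> = - (2 * real j + 2 * real m) * (x * poly (pderiv ?W) x) * x ^ l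
      - 2 * real j * (1 - x * x) ^ j * x ^ l
      - 4 * real j * (1 - x * x) ^ j * (x * poly (pderiv ?Y) x)
      + (1 - x * x) * (1 - x * x) ^ j * poly (pderiv (pderiv ?Y)) x
      - 2 * (real m + 1) * (1 - x * x) ^ j * (x * poly (pderiv ?Y) x)"
    unfolding wW2 W1 by (simp add: algebra_simps)
  also have "\<dots> = 4 * (real j + real m) * (real j * (x\<^sup>2 * (1 - x * x) ^ (j - 1) * x ^ l))
      + real l * (real l - 1) * ((1 - x * x) * (1 - x * x) ^ j * x ^ (l - 2))
      - (2 * real j * (2 * real l + 1) + 2 * (real m + 1) * real l) * ((1 - x * x) ^ j * x ^ l)"
    unfolding xW1 Y1 Y2 by (simp add: algebra_simps)
  finally show "poly (gegenbauer_op m (sphere_basis N j)) x = poly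
     (smult (4 * real j * (real j + real m)) (sphere_basis N (j - 1))
     + smult (real (N - 2 * j) * (real (N - 2 * j) - 1)) (sphere_basis N (Suc j))
     - smult (2 * real j * (2 * real (N - 2 * j) + 1) + 2 * (real m + 1) * real (N - 2 * j))
         (sphere_basis N j)) x"
    unfolding up down id[symmetric] l_def[symmetric] by (simp add: algebra_simps)
qed

text \<open>A detailed-balance condition: the weights \<open>c\<close> symmetrise a tridiagonal
  matrix with lowering part \<alpha> and raising part \<gamma>, so lowering one factor amounts to
  raising the other.\<close>

lemma sum_shift_exchange:
  fixes c \<alpha> \<gamma> E b :: "nat \<Rightarrow> real"
  assumes "\<alpha> 0 = 0" "\<gamma> J = 0" "\<And>j. j < J \<Longrightarrow> c (Suc j) * \<alpha> (Suc j) = c j * \<gamma> j"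
  shows "(\<Sum>j\<le>J. c j * \<alpha> j * E j * b (j - 1)) = (\<Sum>j\<le>J. c j * \<gamma> j * E (Suc j) * b j)"
proof (cases J)
  case (Suc K)
  have "(\<Sum>j\<le>J. c j * \<alpha> j * E j * b (j - 1))
      = (\<Sum>j\<le>K. (c (Suc j) * \<alpha> (Suc j)) * E (Suc j) * b j)"
    unfolding Suc using assms(1) by (subst sum.atMost_Suc_shift) simp
  also have "\<dots> = (\<Sum>j\<le>K. c j * \<gamma> j * E (Suc j) * b j)"
    using assms(3) Suc by (intro sum.cong) auto
  also have "\<dots> = (\<Sum>j\<le>J. c j * \<gamma> j * E (Suc j) * b j)"
    using assms(2) Suc by simp
  finally show ?thesis .
qed (use assms in simp)

text \<open>With its second variable equal to 1, the kernel of degree \<open>N\<close> keeps only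
  the term j = 0, a multiple of x^N. Hence these moments determine the Funk--Hecke factor.\<close>

definition sphere_moment :: "nat \<Rightarrow> nat \<Rightarrow> nat \<Rightarrow> real" where
  "sphere_moment n m N = cos_integral ([:1, 0, -1:] ^ m * [:0, 1:] ^ N * ferrers_poly n m)"

text \<open>Chosen such that the kernel obtained by summing sphere_coeff times a product of two sphere_basis polynomials
  has the same image under the Gegenbauer operator in either variable.\<close>
definition sphere_coeff :: "nat \<Rightarrow> nat \<Rightarrow> nat \<Rightarrow> real" where
  "sphere_coeff m N j = 1 / (fact j * fact (m + j) * fact (N - 2 * j) * 4 ^ j)"

text \<open>Applied in \<open>y\<close>, the operator moves to the other variable of the kernel by
  the choice of \<open>sphere_coeff\<close>, and from there to the Ferrers polynomial by
  self-adjointness. The sum is therefore an eigenpolynomial in \<open>y\<close> with the Ferrers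
  eigenvalue, hence a multiple of the Ferrers polynomial; the values at 1 give the factor.\<close>

lemma sphere_kernel_eigen:
  fixes n m N :: nat
  defines "E \<equiv> \<lambda>j. cos_integral ([:1, 0, -1:] ^ m * sphere_basis N j * ferrers_poly n m)"
  assumes "m \<le> n"
  shows "poly (ferrers_poly n m) 1 * (\<Sum>j\<le>N div 2. sphere_coeff m N j * E j * poly (sphere_basis N j) y)
    = sphere_moment n m N / (fact m * fact N) * poly (ferrers_poly n m) y"
proof -
  define p where "p = ferrers_poly n m"
  define \<Lambda> where "\<Lambda> = - ((real n - real m) * (real n + real m + 1))"
  define \<alpha> where "\<alpha> = (\<lambda>j. 4 * real j * (real j + real m))"
  define \<gamma> where "\<gamma> = (\<lambda>j. real (N - 2 * j) * (real (N - 2 * j) - 1))"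
  define \<beta> where "\<beta> = (\<lambda>j. 2 * real j * (2 * real (N - 2 * j) + 1) + 2 * (real m + 1) * real (N - 2 * j))"
  define c where "c = sphere_coeff m N"
  define J where "J = N div 2"
  define F where "F = (\<Sum>j\<le>J. smult (c j * E j) (sphere_basis N j))"
  have Lp: "gegenbauer_op m p = smult \<Lambda> p"
    unfolding p_def \<Lambda>_def by (rule ferrers_poly_eigen)
  have Lb: "gegenbauer_op m (sphere_basis N j) = smult (\<alpha> j) (sphere_basis N (j - 1))
      + smult (\<gamma> j) (sphere_basis N (Suc j)) - smult (\<beta> j) (sphere_basis N j)" if "j \<le> J" for j
    unfolding \<alpha>_def \<beta>_def \<gamma>_def using that by (intro gegenbauer_op_sphere_basis) (simp add: J_def)
  \<comment> \<open>The integral of the operator applied to a basis element is computed twice, by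
    the tridiagonal action and by self-adjointness.\<close>
  have E_rec: "\<alpha> j * E (j - 1) + \<gamma> j * E (Suc j) - \<beta> j * E j = \<Lambda> * E j" if "j \<le> J" for j
  proof -
    have "cos_integral ([:1, 0, -1:] ^ m * gegenbauer_op m (sphere_basis N j) * p)
        = \<alpha> j * E (j - 1) + \<gamma> j * E (Suc j) - \<beta> j * E j"
      unfolding Lb[OF that] E_def p_def[symmetric] ring_distribs mult_smult_left mult_smult_right
        cos_integral_diff cos_integral_add cos_integral_smult ..
    moreover have "cos_integral ([:1, 0, -1:] ^ m * sphere_basis N j * gegenbauer_op m p) = \<Lambda> * E j"
      unfolding Lp E_def p_def[symmetric] mult_smult_right cos_integral_smult ..
    ultimately show ?thesis
      by (simp only: gegenbauer_op_selfadjoint)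
  qed
  have c_rec: "c (Suc j) * \<alpha> (Suc j) = c j * \<gamma> j" if "j < J" for j
  proof -
    have "N - 2 * j = Suc (Suc (N - 2 * Suc j))"
      using that unfolding J_def by arith
    then obtain l where l: "N - 2 * j = Suc (Suc l)" "N - 2 * Suc j = l"
      by blast
    show ?thesis
      unfolding c_def sphere_coeff_def \<alpha>_def \<gamma>_def l by (simp add: divide_simps) (simp add: algebra_simps)
  qed
  \<comment> \<open>At the last index the exponent of x is 0 or 1, so the sum over {..J} is closed
    under the operator.\<close>
  have \<gamma>J: "\<gamma> J = 0"
  proof -
    have "N - 2 * J = 0 \<or> N - 2 * J = 1" unfolding J_def by arith
    then show ?thesis unfolding \<gamma>_def by auto
  qed
  have exch: "(\<Sum>j\<le>J. c j * \<alpha> j * e j * b (j - 1)) = (\<Sum>j\<le>J. c j * \<gamma> j * e (Suc j) * b j)"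
    for e b :: "nat \<Rightarrow> real"
    by (rule sum_shift_exchange) (use c_rec \<gamma>J in \<open>auto simp: \<alpha>_def\<close>)
  have "gegenbauer_op m F = smult \<Lambda> F"
  proof (rule poly_eq_poly_eq_iff[THEN iffD1], rule ext)
    fix x
    let ?b = "\<lambda>j. poly (sphere_basis N j) x"
    have "poly (gegenbauer_op m F) x
        = (\<Sum>j\<le>J. c j * E j * (\<alpha> j * ?b (j - 1) + \<gamma> j * ?b (Suc j) - \<beta> j * ?b j))"
      unfolding F_def gegenbauer_op_sum gegenbauer_op_smult poly_sum
      by (intro sum.cong) (simp_all add: Lb)
    also have "\<dots> = (\<Sum>j\<le>J. c j * \<alpha> j * E j * ?b (j - 1)) + (\<Sum>j\<le>J. c j * \<gamma> j * ?b (Suc j) * E j)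
        - (\<Sum>j\<le>J. c j * \<beta> j * E j * ?b j)"
      unfolding sum.distrib[symmetric] sum_subtractf[symmetric]
      by (intro sum.cong) (simp_all add: algebra_simps)
    \<comment> \<open>\<open>exch\<close> is used twice: lowering the basis becomes raising
      \<open>E\<close>, and raising the basis becomes lowering \<open>E\<close>.\<close>
    also have "\<dots> = (\<Sum>j\<le>J. c j * \<gamma> j * E (Suc j) * ?b j) + (\<Sum>j\<le>J. c j * \<alpha> j * ?b j * E (j - 1))
        - (\<Sum>j\<le>J. c j * \<beta> j * E j * ?b j)"
      using exch[of E ?b] exch[of ?b E] by simp
    also have "\<dots> = (\<Sum>j\<le>J. c j * ?b j * (\<alpha> j * E (j - 1) + \<gamma> j * E (Suc j) - \<beta> j * E j))"
      unfolding sum.distrib[symmetric] sum_subtractf[symmetric]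
      by (intro sum.cong) (simp_all add: algebra_simps)
    also have "\<dots> = (\<Sum>j\<le>J. c j * ?b j * (\<Lambda> * E j))"
      by (intro sum.cong refl) (simp only: E_rec atMost_iff)
    also have "\<dots> = poly (smult \<Lambda> F) x"
      by (simp add: F_def poly_sum sum_distrib_left mult_ac)
    finally show "poly (gegenbauer_op m F) x = poly (smult \<Lambda> F) x" .
  qed
  \<comment> \<open>This combination vanishes at 1 by construction, so uniqueness of
    eigenpolynomials forces it to be zero.\<close>
  then have "gegenbauer_op m (smult (poly p 1) F - smult (poly F 1) p)
      = smult \<Lambda> (smult (poly p 1) F - smult (poly F 1) p)"
    by (simp add: gegenbauer_op_diff gegenbauer_op_smult Lp smult_diff_right mult.commute)
  then have "smult (poly p 1) F - smult (poly F 1) p = 0"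
    by (rule gegenbauer_op_eigen_unique) simp
  then have "poly (smult (poly p 1) F - smult (poly F 1) p) y = 0" by simp
  then have "poly p 1 * poly F y = poly F 1 * poly p y" by simp
  moreover have "poly F 1 = sphere_moment n m N / (fact m * fact N)"
  proof -
    have "poly F 1 = (\<Sum>j\<le>J. if j = 0 then c 0 * E 0 else 0)"
      unfolding F_def poly_sum by (intro sum.cong) (auto simp: sphere_basis_def)
    also have "\<dots> = c 0 * E 0" by simp
    finally show ?thesis
      by (simp add: c_def sphere_coeff_def E_def sphere_basis_def sphere_moment_def del: mult_pCons_left mult_pCons_right)
  qed
  moreover have "poly F y = (\<Sum>j\<le>J. c j * E j * poly (sphere_basis N j) y)"
    by (simp add: F_def poly_sum)
  ultimately show ?thesis
    unfolding c_def J_def p_def by simp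
qed

text \<open>The sum over j of these terms, times (m + N)!, is the m-th Fourier coefficient of
  (D + B cos \<phi>) ^ (m + N).\<close>
definition sphere_term :: "nat \<Rightarrow> nat \<Rightarrow> nat \<Rightarrow> real \<Rightarrow> real \<Rightarrow> real" where
  "sphere_term m N j D B = (B / 2) ^ (m + 2 * j) * D ^ (N - 2 * j)
     / (fact j * fact (m + j) * fact (N - 2 * j))"

text \<open>The factor 2^m comes from (B/2)^m in \<open>sphere_term\<close>, and the division by the
  value at 1 normalises the Ferrers polynomial.\<close>

definition sphere_eigenvalue :: "nat \<Rightarrow> nat \<Rightarrow> nat \<Rightarrow> real" where
  "sphere_eigenvalue n m N =
     sphere_moment n m N / (2 ^ m * fact m * fact N * poly (ferrers_poly n m) 1)"

text \<open>The power (sin t)^m contained in each \<open>sphere_term\<close> and the one in the test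
  function combine to the weight (1 - x^2)^m of \<open>sphere_kernel_eigen\<close>.\<close>

lemma funk_hecke_monomial:
  assumes "m \<le> n"
  shows "((\<lambda>t. (\<Sum>j\<le>N div 2. sphere_term m N j (cos t * cos t') (sin t * sin t'))
            * (sin t ^ m * poly (ferrers_poly n m) (cos t)) * sin t)
     has_integral sphere_eigenvalue n m N * (sin t' ^ m * poly (ferrers_poly n m) (cos t'))) {0..pi}"
proof -
  define p where "p = ferrers_poly n m"
  define E where "E = (\<lambda>j. cos_integral ([:1, 0, -1:] ^ m * sphere_basis N j * p))"
  define q where "q = (\<Sum>j\<le>N div 2. smult (sphere_coeff m N j * poly (sphere_basis N j) (cos t'))
    ([:1, 0, -1:] ^ m * sphere_basis N j * p))"
  have p1: "poly p 1 \<noteq> 0"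
    unfolding p_def poly_ferrers_poly_1[OF assms] by simp
  have summand: "sphere_term m N j (cos t * cos t') (sin t * sin t') * (sin t ^ m * poly p (cos t))
      = (sin t' / 2) ^ m * (sphere_coeff m N j * poly (sphere_basis N j) (cos t')
          * poly ([:1, 0, -1:] ^ m * sphere_basis N j * p) (cos t))" for t j
  proof -
    have s: "1 - cos u * cos u = (sin u)\<^sup>2" for u :: real
      by (simp add: sin_squared_eq flip: power2_eq_square)
    show ?thesis
      unfolding sphere_term_def sphere_coeff_def sphere_basis_def
      by (simp add: s power_mult_distrib power_divide power_add power_mult power_even_eq
          power2_eq_square[of "x ^ m" for x :: real])
        (simp add: power_mult[symmetric] power_add[symmetric] mult_2_right mult_ac add_ac)
  qed
  have "((\<lambda>t. (sin t' / 2) ^ m * (poly q (cos t) * sin t)) has_integral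
      (sin t' / 2) ^ m * cos_integral q) {0..pi}"
    by (intro has_integral_mult_right cos_integral_has)
  also have "(\<lambda>t. (sin t' / 2) ^ m * (poly q (cos t) * sin t)) =
      (\<lambda>t. (\<Sum>j\<le>N div 2. sphere_term m N j (cos t * cos t') (sin t * sin t'))
            * (sin t ^ m * poly p (cos t)) * sin t)"
    unfolding q_def poly_sum sum_distrib_left sum_distrib_right summand
    by (intro ext sum.cong) simp_all
  also have "cos_integral q = (\<Sum>j\<le>N div 2. sphere_coeff m N j * E j * poly (sphere_basis N j) (cos t'))"
  proof -
    have "cos_integral (\<Sum>j\<in>A. f j) = (\<Sum>j\<in>A. cos_integral (f j))" for f and A :: "nat set"
      by (induction A rule: infinite_finite_induct)
         (simp_all add: cos_integral_add, simp_all add: cos_integral_def)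
    then show ?thesis
      unfolding q_def E_def by (simp only: cos_integral_smult) (simp only: mult_ac)
  qed
  also have "\<dots> = sphere_moment n m N / (fact m * fact N) * poly p (cos t') / poly p 1"
    using sphere_kernel_eigen[OF assms, of N "cos t'"] p1
    unfolding E_def p_def[symmetric] by (simp add: field_simps)
  also have "(sin t' / 2) ^ m * \<dots> = sphere_eigenvalue n m N * (sin t' ^ m * poly p (cos t'))"
    unfolding sphere_eigenvalue_def p_def[symmetric] by (simp add: power_divide mult_ac)
  finally show ?thesis unfolding p_def .
qed

section \<open>Moments of the Ferrers polynomials and the Funk--Hecke factors in closed form\<close>

text \<open>Self-adjointness applied to x^N, on which the operator acts by a two-term formula, and
  to the Ferrers polynomial, on which it acts as a scalar.\<close>

lemma sphere_moment_rec:
  "(real N + real m - real n) * (real N + real m + real n + 1) * sphere_moment n m N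
     = real N * (real N - 1) * sphere_moment n m (N - 2)"
proof -
  define p where "p = ferrers_poly n m"
  define \<Lambda> where "\<Lambda> = - ((real n - real m) * (real n + real m + 1))"
  have "gegenbauer_op m ([:0, 1:] ^ N) = smult (real N * (real N - 1)) ([:1, 0, -1:] * [:0, 1:] ^ (N - 2))
      - smult (2 * (real m + 1) * real N) ([:0, 1:] ^ N)"
    using gegenbauer_op_sphere_basis[of 0 N m] by (simp add: sphere_basis_def numeral_2_eq_2)
  also have "smult (real N * (real N - 1)) ([:1, 0, -1:] * [:0, 1:] ^ (N - 2))
      = smult (real N * (real N - 1)) ([:0, 1:] ^ (N - 2)) - smult (real N * (real N - 1)) ([:0, 1:] ^ N)"
  proof (cases "N < 2")
    case False
    then obtain k where "N = Suc (Suc k)"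
      by (metis One_nat_def Suc_1 less_2_cases_iff not0_implies_Suc)
    then show ?thesis
      by (intro poly_eq_poly_eq_iff[THEN iffD1] ext) (simp add: algebra_simps)
  next
    case True
    \<comment> \<open>For N < 2 the truncated exponent N - 2 is multiplied by zero.\<close>
    then have "real N * (real N - 1) = 0" by (auto simp: less_2_cases_iff)
    then show ?thesis by (simp only: smult_0_left)
  qed
  finally have X: "gegenbauer_op m ([:0, 1:] ^ N) = smult (real N * (real N - 1)) ([:0, 1:] ^ (N - 2))
      - smult (real N * (real N - 1)) ([:0, 1:] ^ N) - smult (2 * (real m + 1) * real N) ([:0, 1:] ^ N)" .
  have "cos_integral ([:1, 0, -1:] ^ m * gegenbauer_op m ([:0, 1:] ^ N) * p)
      = real N * (real N - 1) * sphere_moment n m (N - 2)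
        - real N * (real N - 1) * sphere_moment n m N - 2 * (real m + 1) * real N * sphere_moment n m N"
    unfolding X sphere_moment_def p_def[symmetric] ring_distribs mult_smult_left mult_smult_right
        cos_integral_diff cos_integral_add cos_integral_smult ..
  moreover have "cos_integral ([:1, 0, -1:] ^ m * [:0, 1:] ^ N * gegenbauer_op m p)
      = \<Lambda> * sphere_moment n m N"
    unfolding p_def ferrers_poly_eigen \<Lambda>_def sphere_moment_def mult_smult_right cos_integral_smult ..
  ultimately have "real N * (real N - 1) * sphere_moment n m (N - 2)
        - real N * (real N - 1) * sphere_moment n m N - 2 * (real m + 1) * real N * sphere_moment n m N
      = \<Lambda> * sphere_moment n m N"
    by (simp only: gegenbauer_op_selfadjoint)
  then show ?thesis by (simp add: \<Lambda>_def algebra_simps)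
qed

text \<open>The left factor in \<open>sphere_moment_rec\<close> vanishes only at N = n - m.
  Descending in steps of two therefore avoids that value and ends at N < 2, where the right-hand
  side is zero.\<close>

lemma sphere_moment_eq_0:
  assumes "m \<le> n" "N < n - m \<or> odd (N - (n - m))"
  shows "sphere_moment n m N = 0"
  using assms(2)
proof (induction N rule: less_induct)
  case (less N)
  have "N + m \<noteq> n" using less.prems assms(1) by auto
  then have ne: "(real N + real m - real n) * (real N + real m + real n + 1) \<noteq> 0"
    by (simp flip: of_nat_add)
  have "real N * (real N - 1) * sphere_moment n m (N - 2) = 0"
  proof (cases "N < 2")
    case True
    then show ?thesis by (auto simp: less_2_cases_iff)
  next
    case False
    then have "N - 2 < n - m \<or> odd (N - 2 - (n - m))"
      using less.prems by (cases "N < n - m"; cases "N = Suc (n - m)") (auto simp: not_less even_diff_nat)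
    then show ?thesis using less.IH[of "N - 2"] False by simp
  qed
  then show ?case
    using sphere_moment_rec[of N m n] ne by (metis mult_eq_0_iff)
qed

text \<open>Integration by parts raises m by one at the cost of an explicit factor, until the Ferrers polynomial is constant.\<close>
lemma sphere_moment_first:
  assumes "m \<le> n"
  shows "sphere_moment n m (n - m)
     = (-2) ^ m * fact (n + m) / (2 ^ n * fact n) * cos_integral ([:1, 0, -1:] ^ n)"
  using assms
proof (induction m rule: inc_induct)
  case base
  have "sphere_moment n n (n - n) = (-1) ^ n * fact (2 * n) / fact n * cos_integral ([:1, 0, -1:] ^ n)"
    by (simp add: sphere_moment_def ferrers_poly_same cos_integral_smult)
  moreover have "(-2 :: real) ^ n = (-1) ^ n * 2 ^ n"
    by (simp flip: power_mult_distrib)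
  ultimately show ?case by (simp add: mult_2)
next
  case (step m)
  define N where "N = n - Suc m"
  have nm: "n - m = Suc N" using step.hyps by (simp add: N_def)
  let ?w = "[:1, 0, -1:] :: real poly" and ?X = "[:0, 1:] :: real poly"
  let ?p = "ferrers_poly n m"
  have p': "ferrers_poly n (Suc m) = smult (-2) (pderiv ?p)"
    by (simp add: pderiv_ferrers_poly)
  let ?h = "?w ^ Suc m * ?X ^ N"
  have "cos_integral (pderiv (?h * ?p)) = 0"
    by (subst cos_integral_pderiv) simp
  moreover have "pderiv (?h * ?p) = pderiv ?h * ?p + ?h * pderiv ?p"
    by (simp only: pderiv_mult[of ?h ?p]) (simp only: ac_simps)
  ultimately have "cos_integral (?h * pderiv ?p) = - cos_integral (pderiv ?h * ?p)"
    by (simp only: cos_integral_add)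
  moreover have "pderiv ?h * ?p = smult (real N) (?w ^ m * ?X ^ (N - 1) * ?p)
      - smult (2 * real m + 2 + real N) (?w ^ m * ?X ^ Suc N * ?p)"
  proof (rule poly_eq_poly_eq_iff[THEN iffD1], rule ext)
    fix x :: real
    have dw: "poly (pderiv (?w ^ Suc m)) x = - (2 * real m + 2) * (x * (1 - x * x) ^ m)"
      by (simp add: pderiv_power_Suc pderiv_pCons algebra_simps del: power_Suc)
    have dX: "poly (pderiv (?X ^ N)) x = real N * x ^ (N - 1)"
      by (simp add: pderiv_power pderiv_pCons)
    have NX: "real N * (x * x ^ (N - 1)) = real N * x ^ N"
      by (cases N) auto
    have "poly (pderiv ?h * ?p) x = ((1 - x * x) * (1 - x * x) ^ m * (real N * x ^ (N - 1))
        - (2 * real m + 2) * (x * (1 - x * x) ^ m) * x ^ N) * poly ?p x"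
      unfolding pderiv_mult poly_mult poly_add dw dX by (simp add: algebra_simps)
    also have "\<dots> = (real N * ((1 - x * x) ^ m * x ^ (N - 1))
        - ((real N * (x * x ^ (N - 1))) * x + (2 * real m + 2) * (x * x ^ N)) * (1 - x * x) ^ m) * poly ?p x"
      by (simp add: algebra_simps)
    also have "\<dots> = poly (smult (real N) (?w ^ m * ?X ^ (N - 1) * ?p)
      - smult (2 * real m + 2 + real N) (?w ^ m * ?X ^ Suc N * ?p)) x"
      unfolding NX by (simp add: algebra_simps)
    finally show "poly (pderiv ?h * ?p) x = \<dots>" .
  qed
  ultimately have "cos_integral (?h * pderiv ?p)
      = (2 * real m + 2 + real N) * sphere_moment n m (Suc N) - real N * sphere_moment n m (N - 1)"
    by (simp only: cos_integral_diff cos_integral_smult sphere_moment_def)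
  \<comment> \<open>For N > 0 the exponent N - 1 lies below n - m, where the moments vanish; for N =
    0 the factor does.\<close>
  moreover have "real N * sphere_moment n m (N - 1) = 0"
    using sphere_moment_eq_0[of m n "N - 1"] step.hyps nm by (cases N) auto
  moreover have "sphere_moment n (Suc m) N = - 2 * cos_integral (?h * pderiv ?p)"
    unfolding sphere_moment_def p' mult_smult_right cos_integral_smult ..
  moreover have "2 * real m + 2 + real N = real n + real m + 1"
    using step.hyps by (simp add: N_def of_nat_diff)
  ultimately have "sphere_moment n (Suc m) N = - 2 * ((real n + real m + 1) * sphere_moment n m (Suc N))"
    by simp
  moreover have "fact (n + Suc m) = (real n + real m + 1) * fact (n + m)"
    by (simp add: algebra_simps)
  ultimately have "- 2 * (real n + real m + 1) * sphere_moment n m (Suc N)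
      = - 2 * (real n + real m + 1) * ((-2) ^ m * fact (n + m) / (2 ^ n * fact n) * cos_integral (?w ^ n))"
    using step.IH unfolding N_def[symmetric] power_Suc
    by (simp only: mult.assoc times_divide_eq_left times_divide_eq_right) (simp only: mult_ac)
  moreover have "- 2 * (real n + real m + 1) \<noteq> 0" by simp
  ultimately show ?case
    unfolding nm by (metis mult_left_cancel)
qed

text \<open>The moment recursion divides by 4 (j + 1) (n + 3/2 + j) at each step, which builds up
  4^j, j! and the Gamma function. In terms of the total degree m + N = n + 2 j the value is
  independent of m.\<close>

lemma sphere_eigenvalue_eq:
  assumes "m \<le> n"
  shows "sphere_eigenvalue n m (n - m + 2 * j)
     = sqrt pi / (2 ^ n * 4 ^ j * fact j * Gamma (real n + 3 / 2 + real j))"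
proof (induction j)
  case 0
  have G: "Gamma (real n + 3 / 2) > 0" by (intro Gamma_real_pos) simp
  have "(-2 :: real) ^ m = (-1) ^ m * 2 ^ m"
    by (simp flip: power_mult_distrib)
  then have "sphere_eigenvalue n m (n - m) = cos_integral ([:1, 0, -1:] ^ n) / (2 ^ n * fact n)"
    unfolding sphere_eigenvalue_def sphere_moment_first[OF assms] poly_ferrers_poly_1[OF assms]
    by (simp add: divide_simps)
  also have "cos_integral ([:1, 0, -1:] ^ n) = sqrt pi * fact n / Gamma (real n + 3 / 2)"
    using cos_integral_sin_power[of n] G by (metis eq_divide_eq less_irrefl)
  finally show ?case by simp
next
  case (Suc j)
  define N where "N = n - m + 2 * j"
  have N: "n - m + 2 * Suc j = Suc (Suc N)" by (simp add: N_def)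
  have r: "real N = real n - real m + 2 * real j" using assms by (simp add: N_def of_nat_diff)
  define K where "K = (real N + 2) * (real N + 1)"
  have "(2 * real j + 2) * (2 * real n + 2 * real j + 3) * sphere_moment n m (Suc (Suc N))
      = K * sphere_moment n m N"
  proof -
    have "real (Suc (Suc N)) + real m - real n = 2 * real j + 2"
      "real (Suc (Suc N)) + real m + real n + 1 = 2 * real n + 2 * real j + 3"
      "real (Suc (Suc N)) * (real (Suc (Suc N)) - 1) = K"
      "Suc (Suc N) - 2 = N"
      by (simp_all add: r K_def algebra_simps)
    with sphere_moment_rec[of "Suc (Suc N)" m n] show ?thesis by (simp only:)
  qed
  moreover have "fact (Suc (Suc N)) = K * fact N"
    by (simp add: K_def algebra_simps)
  moreover have "K > 0" by (simp add: K_def)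
  ultimately have "(2 * real j + 2) * (2 * real n + 2 * real j + 3) * sphere_eigenvalue n m (Suc (Suc N))
      = sphere_eigenvalue n m N"
    unfolding sphere_eigenvalue_def by (simp del: fact_Suc)
  then have "sphere_eigenvalue n m (Suc (Suc N))
      = sphere_eigenvalue n m N / (4 * (real j + 1) * (real n + 3 / 2 + real j))"
  proof -
    have "(2 * real j + 2) * (2 * real n + 2 * real j + 3) = 4 * (real j + 1) * (real n + 3 / 2 + real j)"
      by (simp add: algebra_simps)
    moreover have "4 * (real j + 1) * (real n + 3 / 2 + real j) > 0"
      by simp
    ultimately show ?thesis
      using \<open>_ = sphere_eigenvalue n m N\<close> by (metis less_irrefl nonzero_mult_div_cancel_left)
  qed
  also have "\<dots> = sqrt pi / (2 ^ n * 4 ^ Suc j * fact (Suc j)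
      * ((real n + 3 / 2 + real j) * Gamma (real n + 3 / 2 + real j)))"
    unfolding N_def Suc by (simp add: mult_ac add_ac)
  also have "(real n + 3 / 2 + real j) * Gamma (real n + 3 / 2 + real j) = Gamma (real n + 3 / 2 + real (Suc j))"
    using Gamma_plus1[of "real n + 3 / 2 + real j"] nonpos_Ints_nonpos[of "real n + 3 / 2 + real j"]
    by (force simp: algebra_simps)
  finally show ?case unfolding N .
qed

lemma sphere_eigenvalue_eq_0:
  assumes "m \<le> n" "N < n - m \<or> odd (N - (n - m))"
  shows "sphere_eigenvalue n m N = 0"
  using sphere_moment_eq_0[OF assms] by (simp add: sphere_eigenvalue_def)

section \<open>Series for the Legendre functions\<close>

lemma powr_of_real_mult:
  assumes "x > 0" "y > 0"
  shows "complex_of_real (x * y) powr c = complex_of_real x powr c * complex_of_real y powr c"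
  using assms by (simp add: powr_times_real)

lemma powr_of_real_minus_add_nat:
  assumes "x > 0"
  shows "complex_of_real x powr (- (b + of_nat l)) = complex_of_real x powr (- b) / of_real x ^ l"
proof -
  have "complex_of_real x powr (- (b + of_nat l)) = complex_of_real x powr (- b) * of_real x powr (- of_nat l)"
    by (simp flip: powr_add)
  also have "complex_of_real x powr (- of_nat l) = 1 / of_real x ^ l"
    using assms by (simp add: powr_minus powr_nat' divide_inverse)
  finally show ?thesis by simp
qed

lemma Gamma_add_nat:
  fixes a :: complex
  assumes "a \<notin> \<int>\<^sub>\<le>\<^sub>0"
  shows "Gamma (a + of_nat k) = Gamma a * pochhammer a k"
  using assms by (simp add: pochhammer_Gamma Gamma_eq_zero_iff)

lemma add_nat_notin_nonpos_Ints:
  fixes a :: complex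
  assumes "a \<notin> \<int>\<^sub>\<le>\<^sub>0"
  shows "a + of_nat k \<notin> \<int>\<^sub>\<le>\<^sub>0"
  using assms nonpos_Ints_diff_Nats[of "a + of_nat k" "of_nat k"] by auto

text \<open>The hypergeometric series terminates on both sides, and its lowest power ((1 - x)/2)^m
  combines with the prefactor ((1 + x)/(1 - x))^(m/2) to (sin t / 2)^m.\<close>

lemma FerrersP_eq:
  assumes "0 < t" "t < pi"
  shows "FerrersP (of_nat m) (of_nat n) (cos t)
     = of_real (sin t ^ m / 2 ^ m * poly (ferrers_poly n m) (cos t))"
proof -
  define x where "x = cos t"
  define u where "u = (1 - x) / 2"
  have s: "sin t > 0" using assms by (rule sin_gt_zero)
  have x1: "x < 1"
    using assms cos_monotone_0_pi[of 0 t] by (simp add: x_def)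
  define f where "f = (\<lambda>k. pochhammer (of_nat n + 1) k * pochhammer (- of_nat n) k
      * rGamma (1 - of_nat m + of_nat k) / fact k * complex_of_real u ^ k)"
  \<comment> \<open>Below m the reciprocal Gamma function is evaluated at one of its zeros; above m
    + n, and already above n, the Pochhammer symbol of -n vanishes.\<close>
  have f0: "f k = 0" if "k \<notin> {m..m + n}" for k
  proof (cases "k < m")
    case True
    have "1 - of_nat m + of_nat k = - (of_nat (m - 1 - k) :: complex)"
      using True by (simp add: of_nat_diff)
    then show ?thesis by (simp add: f_def rGamma_eq_zero_iff)
  next
    case False
    then show ?thesis using that by (simp add: f_def pochhammer_of_nat_eq_0_iff)
  qed
  have fi: "f (m + i) = of_real (u ^ m * (ferrers_coeff n m i * u ^ i))" for i
  proof -
    have "rGamma (1 - of_nat m + of_nat (m + i)) = (1 / fact i :: complex)"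
      using Gamma_fact[of i, where ?'a = complex] by (simp add: rGamma_inverse_Gamma divide_inverse)
    moreover have "pochhammer (of_nat n + 1) k = complex_of_real (pochhammer (real n + 1) k)"
      "pochhammer (- of_nat n) k = complex_of_real (pochhammer (- real n) k)" for k
      by (simp_all flip: pochhammer_of_real)
    ultimately show ?thesis
      by (simp add: f_def ferrers_coeff_def power_add)
  qed
  have "hyperF (of_nat n + 1) (- of_nat n) (1 - of_nat m) (of_real u) = (\<Sum>k\<in>{m..m + n}. f k)"
    unfolding hyperF_def f_def[symmetric] using f0 by (intro suminf_finite) auto
  also have "\<dots> = (\<Sum>i\<le>n. f (m + i))"
    by (rule sum.reindex_bij_witness[of _ "\<lambda>i. m + i" "\<lambda>k. k - m"]) auto
  also have "\<dots> = of_real (u ^ m * (\<Sum>i\<le>n. ferrers_coeff n m i * u ^ i))"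
    by (simp add: fi sum_distrib_left)
  also have "(\<Sum>i\<le>n. ferrers_coeff n m i * u ^ i) = poly (ferrers_poly n m) x"
    by (simp add: ferrers_poly_def poly_sum u_def diff_divide_distrib)
  finally have H: "hyperF (of_nat n + 1) (- of_nat n) (1 - of_nat m) (of_real u)
      = of_real (u ^ m * poly (ferrers_poly n m) x)" .
  define y where "y = sin t / (1 - x)"
  have y: "y > 0" using s x1 by (simp add: y_def)
  have "(sin t)\<^sup>2 = (1 + x) * (1 - x)"
    by (simp add: x_def sin_squared_eq power2_eq_square algebra_simps)
  then have "(1 + x) / (1 - x) = y\<^sup>2"
    using x1 by (simp add: y_def power_divide power2_eq_square)
  also have "\<dots> = y powr 2" using y by simp
  finally have "complex_of_real ((1 + x) / (1 - x)) powr (of_nat m / 2)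
      = complex_of_real ((y powr 2) powr (real m / 2))"
    by (subst powr_of_real[symmetric]) auto
  also have "(y powr 2) powr (real m / 2) = y ^ m"
    using y by (simp add: powr_powr powr_realpow del: powr_numeral)
  finally have "FerrersP (of_nat m) (of_nat n) x = of_real ((y * u) ^ m * poly (ferrers_poly n m) x)"
    unfolding FerrersP_def u_def[symmetric] H by (simp add: power_mult_distrib)
  also have "y * u = sin t / 2" using x1 by (simp add: y_def u_def)
  finally show ?thesis by (simp add: x_def power_divide)
qed

text \<open>The duplication formula for Pochhammer symbols merges the two numerator parameters into
  Gamma(a + 2 j). Convergence to \<open>S\<close> is assumed because each application already has
  the value of the sum.\<close>

lemma LegendreQ_eq:
  fixes a \<mu> \<nu> :: complex
  defines "a \<equiv> \<nu> + \<mu> + 1"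
  assumes "x > 1" "a \<notin> \<int>\<^sub>\<le>\<^sub>0"
    and S: "(\<lambda>j. Gamma (a + of_nat (2 * j)) * rGamma (\<nu> + 3 / 2 + of_nat j) / (fact j * 4 ^ j)
           * of_real x powr (- (a + of_nat (2 * j)))) sums S"
  shows "LegendreQ \<mu> \<nu> (of_real x) = exp (\<mu> * of_real pi * \<i>) * of_real (sqrt pi)
     / 2 powr (\<nu> + 1) * of_real (x\<^sup>2 - 1) powr (\<mu> / 2) * S"
proof -
  have G: "Gamma a \<noteq> 0" using assms by (simp add: Gamma_eq_zero_iff)
  have p: "of_real x powr a \<noteq> (0 :: complex)" using assms by simp
  have term_eq: "pochhammer ((\<nu> + \<mu>) / 2 + 1) j * pochhammer ((\<nu> + \<mu> + 1) / 2) j * rGamma (\<nu> + 3 / 2 + of_nat j)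
       / fact j * (1 / (of_real x)\<^sup>2) ^ j =
      Gamma (a + of_nat (2 * j)) * rGamma (\<nu> + 3 / 2 + of_nat j) / (fact j * 4 ^ j)
           * of_real x powr (- (a + of_nat (2 * j))) * (of_real x powr a / Gamma a)" for j
  proof -
    have "Gamma (a + of_nat (2 * j)) = Gamma a * pochhammer (2 * (a / 2)) (2 * j)"
      using Gamma_add_nat[OF assms(3), of "2 * j"] by simp
    also have "\<dots> = Gamma a * (4 ^ j * pochhammer ((\<nu> + \<mu> + 1) / 2) j * pochhammer ((\<nu> + \<mu>) / 2 + 1) j)"
      by (subst pochhammer_double) (simp add: a_def power_mult add_divide_distrib add_ac)
    finally have g: "Gamma (a + of_nat (2 * j))
      = Gamma a * (4 ^ j * pochhammer ((\<nu> + \<mu> + 1) / 2) j * pochhammer ((\<nu> + \<mu>) / 2 + 1) j)" .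
    have "of_real x powr (- (a + of_nat (2 * j))) = 1 / (of_real x powr a) * (1 / (complex_of_real x)\<^sup>2) ^ j"
    proof -
      have "x > 0" using assms(2) by simp
      from powr_of_real_minus_add_nat[OF this] show ?thesis
        by (simp only: powr_minus power_divide power_mult divide_inverse) (simp add: power_inverse)
    qed
    then show ?thesis unfolding g using G p by simp
  qed
  have "hyperF ((\<nu> + \<mu>) / 2 + 1) ((\<nu> + \<mu> + 1) / 2) (\<nu> + 3 / 2) (1 / (of_real x)\<^sup>2)
      = S * (of_real x powr a / Gamma a)"
    unfolding hyperF_def term_eq by (rule sums_unique[symmetric]) (rule sums_mult2[OF S])
  then show ?thesis
    unfolding LegendreQ_def a_def[symmetric] using G p by simp
qed

text \<open>The binomial series of (1 - D/z)^(-b), multiplied by Gamma(b) z^(-b).\<close>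

lemma Gamma_binomial_sums:
  fixes b :: complex
  assumes "b \<notin> \<int>\<^sub>\<le>\<^sub>0" "\<bar>D\<bar> < z"
  shows "(\<lambda>l. Gamma (b + of_nat l) / fact l * of_real z powr (- (b + of_nat l)) * of_real D ^ l)
     sums (Gamma b * of_real (z - D) powr (- b))"
proof -
  have z: "z > 0" using assms by linarith
  have "norm (complex_of_real (- D / z)) < 1" using assms z by (simp add: norm_divide)
  from gen_binomial_complex[OF this, of "- b"]
  have "(\<lambda>l. (Gamma b * of_real z powr (- b)) * ((- b gchoose l) * of_real (- D / z) ^ l))
      sums ((Gamma b * of_real z powr (- b)) * (1 + of_real (- D / z)) powr (- b))"
    by (rule sums_mult)
  also have "(\<lambda>l. (Gamma b * of_real z powr (- b)) * ((- b gchoose l) * of_real (- D / z) ^ l))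
      = (\<lambda>l. Gamma (b + of_nat l) / fact l * of_real z powr (- (b + of_nat l)) * of_real D ^ l)"
  proof
    fix l
    have "(- 1) ^ l * complex_of_real (- D / z) ^ l = of_real D ^ l / of_real z ^ l"
      by (simp flip: power_mult_distrib power_divide)
    moreover have "c * p / f * x = p / f * (c * x)" for c p f x :: complex
      by simp
    ultimately have "(- b gchoose l) * of_real (- D / z) ^ l
        = pochhammer b l / fact l * (of_real D ^ l / of_real z ^ l)"
      by (simp only: gbinomial_pochhammer minus_minus)
    then show "(Gamma b * of_real z powr (- b)) * ((- b gchoose l) * of_real (- D / z) ^ l)
        = Gamma (b + of_nat l) / fact l * of_real z powr (- (b + of_nat l)) * of_real D ^ l"
      by (simp only: Gamma_add_nat[OF assms(1)] powr_of_real_minus_add_nat[OF z]) simp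
  qed
  also have "1 + complex_of_real (- D / z) = of_real (1 - D / z)" by simp
  also have "(Gamma b * of_real z powr (- b)) * of_real (1 - D / z) powr (- b)
      = Gamma b * of_real (z * (1 - D / z)) powr (- b)"
    using assms z by (subst powr_of_real_mult) (auto simp: field_simps)
  also have "z * (1 - D / z) = z - D" using z by (simp add: field_simps)
  finally show ?thesis .
qed

section \<open>Summation of the kernel\<close>

text \<open>Since the central binomial coefficient is at most 4^j, 1/(j!)^2 is at most 4^j / (2 j)!.
  The terms are then bounded by the even-index terms of (|B| + |D|)^N / N!, uniformly in m.\<close>

lemma sphere_term_bound:
  assumes "\<bar>D\<bar> + \<bar>B\<bar> \<le> 1"
  shows "(\<Sum>j\<le>N div 2. \<bar>sphere_term m N j D B\<bar>) \<le> 1 / fact N"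
proof -
  define h where "h = (\<lambda>i. real (N choose i) * \<bar>B\<bar> ^ i * \<bar>D\<bar> ^ (N - i))"
  have "\<bar>sphere_term m N j D B\<bar> \<le> h (2 * j) / fact N" if "j \<le> N div 2" for j
  proof -
    have j: "2 * j \<le> N" using that by simp
    have "real ((2 * j) choose j) \<le> real (2 ^ (2 * j))"
      using binomial_le_pow2 by (simp only: of_nat_le_iff)
    then have "real ((2 * j) choose j) \<le> 4 ^ j"
      by (simp add: power_mult)
    then have 1: "1 / (fact j * fact j) \<le> 4 ^ j / (fact (2 * j) :: real)"
      by (simp add: binomial_fact field_simps)
    have 2: "1 / (fact j * fact (m + j)) \<le> (1 / (fact j * fact j) :: real)"
      by (intro divide_left_mono mult_left_mono fact_mono) auto
    have 3: "(\<bar>B\<bar> / 2) ^ (m + 2 * j) \<le> (\<bar>B\<bar> / 2) ^ (2 * j)"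
      using assms by (intro power_decreasing) auto
    have "\<bar>sphere_term m N j D B\<bar>
        = (\<bar>B\<bar> / 2) ^ (m + 2 * j) * (1 / (fact j * fact (m + j))) * (\<bar>D\<bar> ^ (N - 2 * j) / fact (N - 2 * j))"
      by (simp add: sphere_term_def abs_mult power_abs)
    also have "\<dots> \<le> (\<bar>B\<bar> / 2) ^ (2 * j) * (4 ^ j / fact (2 * j)) * (\<bar>D\<bar> ^ (N - 2 * j) / fact (N - 2 * j))"
      using 1 2 3 by (intro mult_right_mono mult_mono) auto
    also have "\<dots> = h (2 * j) / fact N"
    proof -
      have "(2 :: real) ^ (2 * j) = 4 ^ j" by (simp add: power_mult)
      then show ?thesis
        using j by (simp add: h_def binomial_fact power_divide)
    qed
    finally show ?thesis .
  qed
  then have "(\<Sum>j\<le>N div 2. \<bar>sphere_term m N j D B\<bar>) \<le> (\<Sum>j\<le>N div 2. h (2 * j) / fact N)"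
    by (intro sum_mono) auto
  also have "\<dots> = (\<Sum>i\<in>(*) 2 ` {..N div 2}. h i / fact N)"
    by (subst sum.reindex) (auto simp: inj_on_def)
  also have "\<dots> \<le> (\<Sum>i\<le>N. h i / fact N)"
    by (intro sum_mono2) (auto simp: h_def)
  also have "\<dots> = (\<bar>B\<bar> + \<bar>D\<bar>) ^ N / fact N"
    by (simp add: h_def binomial_ring sum_divide_distrib)
  also have "\<dots> \<le> 1 / fact N"
    using assms by (intro divide_right_mono power_le_one) auto
  finally show ?thesis .
qed

lemma Gamma_binomial_norm_summable:
  fixes a :: complex
  assumes "a \<notin> \<int>\<^sub>\<le>\<^sub>0" "z > 1"
  shows "(\<lambda>N. norm (Gamma (a + of_nat N) * of_real z powr (- (a + of_nat N))) / fact N) summable_on UNIV"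
proof -
  \<comment> \<open>Convergence of the power series at a point beyond 1 gives absolute convergence
    at 1.\<close>
  obtain y where y: "1 < y" "y < z" using assms(2) dense by blast
  have "summable (\<lambda>l. Gamma (a + of_nat l) / fact l * of_real z powr (- (a + of_nat l)) * of_real y ^ l)"
    using Gamma_binomial_sums[OF assms(1), of y z] y by (auto simp: sums_iff)
  then have "summable (\<lambda>l. norm (Gamma (a + of_nat l) / fact l * of_real z powr (- (a + of_nat l)) * 1 ^ l))"
    by (rule powser_insidea) (use y in auto)
  then show ?thesis
    by (intro norm_summable_imp_summable_on) (simp add: norm_mult norm_divide)
qed

text \<open>One absolutely convergent double series is summed in two ways. By rows, for fixed
  \<open>N\<close>, it consists of the terms that \<open>funk_hecke_monomial\<close> integrates; by
  columns, for fixed \<open>j\<close>, the powers of z are resummed into powers of z - D, which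
  leads to the Q function of half-integer degree.\<close>

lemma sphere_series:
  fixes a :: complex
  assumes a: "a \<notin> \<int>\<^sub>\<le>\<^sub>0" and z: "z > 1" and DB: "\<bar>D\<bar> + \<bar>B\<bar> \<le> 1"
  obtains S where
    "((\<lambda>N. Gamma (a + of_nat N) * of_real z powr (- (a + of_nat N))
         * of_real (\<Sum>j\<le>N div 2. sphere_term m N j D B)) has_sum S) UNIV"
    "(\<lambda>j. Gamma (a + of_nat (2 * j)) * of_real ((B / 2) ^ (m + 2 * j) / (fact j * fact (m + j)))
         * of_real (z - D) powr (- (a + of_nat (2 * j)))) sums S"
proof -
  define g where "g = (\<lambda>N. Gamma (a + of_nat N) * of_real z powr (- (a + of_nat N)))"
  \<comment> \<open>Padding with zeros for 2 j > N lets both summations range over the full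
    product.\<close>
  define h where "h = (\<lambda>(N, j). if j \<le> N div 2 then g N * of_real (sphere_term m N j D B) else 0)"
  define M where "M = (\<lambda>N. norm (g N) / fact N)"
  have M: "M summable_on UNIV"
    unfolding M_def g_def by (rule Gamma_binomial_norm_summable[OF a z])
  have row: "((\<lambda>j. norm (h (N, j))) has_sum (norm (g N) * (\<Sum>j\<le>N div 2. \<bar>sphere_term m N j D B\<bar>))) UNIV" for N
    by (rule has_sum_finite_neutralI[of "{..N div 2}"])
       (auto simp: h_def norm_mult sum_distrib_left intro!: sum.cong)
  have row_le: "norm (g N) * (\<Sum>j\<le>N div 2. \<bar>sphere_term m N j D B\<bar>) \<le> M N" for N
    using mult_left_mono[OF sphere_term_bound[OF DB, where m = m and N = N], of "norm (g N)"]
    by (simp add: M_def)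
  have "(\<lambda>x. norm (h x)) summable_on UNIV \<times> UNIV"
  proof (rule summable_on_SigmaI[OF row])
    show "(\<lambda>N. norm (g N) * (\<Sum>j\<le>N div 2. \<bar>sphere_term m N j D B\<bar>)) summable_on UNIV"
      by (rule summable_on_comparison_test[OF M]) (auto intro!: row_le mult_nonneg_nonneg sum_nonneg)
  qed auto
  then have "h summable_on UNIV \<times> UNIV"
    by (rule abs_summable_summable)
  then obtain S where S: "(h has_sum S) (UNIV \<times> UNIV)"
    by (auto simp: summable_on_def)
  have 1: "((\<lambda>N. g N * of_real (\<Sum>j\<le>N div 2. sphere_term m N j D B)) has_sum S) UNIV"
  proof (rule has_sum_SigmaD[OF S])
    fix N
    show "((\<lambda>j. h (N, j)) has_sum (g N * of_real (\<Sum>j\<le>N div 2. sphere_term m N j D B))) UNIV"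
      by (rule has_sum_finite_neutralI[of "{..N div 2}"])
         (auto simp: h_def sum_distrib_left intro!: sum.cong)
  qed
  define c where "c = (\<lambda>j. Gamma (a + of_nat (2 * j)) * of_real ((B / 2) ^ (m + 2 * j) / (fact j * fact (m + j)))
         * of_real (z - D) powr (- (a + of_nat (2 * j))))"
  have column: "((\<lambda>N. h (N, j)) has_sum c j) UNIV" for j
  proof -
    define k where "k = complex_of_real ((B / 2) ^ (m + 2 * j) / (fact j * fact (m + j)))"
    have "(\<lambda>N. norm (h (N, j))) summable_on UNIV"
    proof (rule summable_on_comparison_test[OF M])
      fix N
      have "norm (h (N, j)) \<le> norm (g N) * (\<Sum>j\<le>N div 2. \<bar>sphere_term m N j D B\<bar>)"
        by (auto simp: h_def norm_mult intro!: mult_left_mono member_le_sum mult_nonneg_nonneg sum_nonneg)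
      also note row_le
      finally show "norm (h (N, j)) \<le> M N" .
    qed auto
    then have "(\<lambda>N. h (N, j)) summable_on UNIV"
      by (rule abs_summable_summable)
    then obtain X where X: "((\<lambda>N. h (N, j)) has_sum X) UNIV"
      by (auto simp: summable_on_def)
    \<comment> \<open>Column \<open>j\<close> starts at N = 2 j. With N = l + 2 j it is a binomial
      series with parameter a + 2 j.\<close>
    have "(\<lambda>l. k * (Gamma (a + of_nat (2 * j) + of_nat l) / fact l
        * of_real z powr (- (a + of_nat (2 * j) + of_nat l)) * of_real D ^ l))
      sums (k * (Gamma (a + of_nat (2 * j)) * of_real (z - D) powr (- (a + of_nat (2 * j)))))"
      using DB z by (intro sums_mult Gamma_binomial_sums add_nat_notin_nonpos_Ints[OF a]) linarith
    also have "(\<lambda>l. k * (Gamma (a + of_nat (2 * j) + of_nat l) / fact l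
        * of_real z powr (- (a + of_nat (2 * j) + of_nat l)) * of_real D ^ l)) = (\<lambda>l. h (l + 2 * j, j))"
    proof
      fix l
      have "a + of_nat (2 * j) + of_nat l = a + of_nat (l + 2 * j)" by simp
      then show "k * (Gamma (a + of_nat (2 * j) + of_nat l) / fact l
        * of_real z powr (- (a + of_nat (2 * j) + of_nat l)) * of_real D ^ l) = h (l + 2 * j, j)"
        by (simp only:) (simp add: h_def g_def k_def sphere_term_def algebra_simps)
    qed
    also have "k * (Gamma (a + of_nat (2 * j)) * of_real (z - D) powr (- (a + of_nat (2 * j)))) = c j"
      by (simp add: c_def k_def)
    finally have "(\<lambda>N. h (N, j)) sums c j"
      by (subst (asm) sums_zero_iff_shift) (auto simp: h_def)
    then show ?thesis
      using X has_sum_imp_sums sums_unique2 by metis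
  qed
  have "((\<lambda>(j, N). h (N, j)) has_sum S) (UNIV \<times> UNIV)"
    using S by (subst has_sum_swap) simp
  then have "(c has_sum S) UNIV"
    by (rule has_sum_SigmaD) (use column in auto)
  then have 2: "c sums S" by (rule has_sum_imp_sums)
  from that 1 2 show ?thesis unfolding c_def g_def by blast
qed

lemma abs_cos_sin_product_le: "\<bar>cos t * cos u\<bar> + \<bar>sin t * sin u\<bar> \<le> (1 :: real)"
proof -
  have "2 * (\<bar>x\<bar> * \<bar>y\<bar>) \<le> x\<^sup>2 + y\<^sup>2" for x y :: real
    using zero_le_power2[of "\<bar>x\<bar> - \<bar>y\<bar>"] by (simp add: power2_diff)
  from this[of "cos t" "cos u"] this[of "sin t" "sin u"] show ?thesis
    using sin_cos_squared_add[of t] sin_cos_squared_add[of u] unfolding abs_mult by linarith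
qed

text \<open>Term-by-term integration: \<open>funk_hecke_monomial\<close> handles each
  \<open>N\<close>, and the Weierstrass M-test justifies exchanging sum and integral.\<close>

lemma funk_hecke_kernel:
  fixes a :: complex
  assumes a: "a \<notin> \<int>\<^sub>\<le>\<^sub>0" and z: "z > 1" and mn: "m \<le> n"
    and V: "\<And>t. ((\<lambda>N. Gamma (a + of_nat N) * of_real z powr (- (a + of_nat N))
         * of_real (\<Sum>j\<le>N div 2. sphere_term m N j (cos t * cos t') (sin t * sin t'))) has_sum V t) UNIV"
  obtains J where
    "((\<lambda>N. Gamma (a + of_nat N) * of_real z powr (- (a + of_nat N)) * of_real (sphere_eigenvalue n m N)
        * of_real (sin t' ^ m * poly (ferrers_poly n m) (cos t'))) has_sum J) UNIV"
    "((\<lambda>t. V t * of_real (sin t ^ m * poly (ferrers_poly n m) (cos t) * sin t)) has_integral J) {0..pi}"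
proof -
  define p where "p = (\<lambda>t. sin t ^ m * poly (ferrers_poly n m) (cos t))"
  define g where "g = (\<lambda>N. Gamma (a + of_nat N) * of_real z powr (- (a + of_nat N)))"
  define v where "v = (\<lambda>N t. \<Sum>j\<le>N div 2. sphere_term m N j (cos t * cos t') (sin t * sin t'))"
  define M where "M = (\<lambda>N. norm (g N) / fact N)"
  have M: "M summable_on UNIV"
    unfolding M_def g_def by (rule Gamma_binomial_norm_summable[OF a z])
  have "compact ((\<lambda>t. p t * sin t) ` {0..pi})"
    unfolding p_def by (intro compact_continuous_image continuous_intros) auto
  then obtain C where C: "\<And>t. t \<in> {0..pi} \<Longrightarrow> \<bar>p t * sin t\<bar> \<le> C"
    by (force dest!: compact_imp_bounded simp: bounded_iff)
  have v: "\<bar>v N t\<bar> \<le> 1 / fact N" for N t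
    using sphere_term_bound[OF abs_cos_sin_product_le[of t t'], of m N]
    unfolding v_def by (rule order_trans[OF sum_abs])
  define f where "f = (\<lambda>N t. g N * of_real (v N t * p t * sin t))"
  \<comment> \<open>The majorant is \<open>M N * C\<close>: \<open>sphere_term_bound\<close> gives
    1/N! uniformly in t, and \<open>C\<close> bounds the continuous test function.\<close>
  have "uniform_limit {0..pi} (\<lambda>X t. \<Sum>N\<in>X. f N t) (\<lambda>t. V t * of_real (p t * sin t)) (finite_subsets_at_top UNIV)"
  proof (rule Weierstrass_m_test_general')
    fix N t assume t: "t \<in> {0..pi}"
    have "norm (f N t) = norm (g N) * (\<bar>v N t\<bar> * \<bar>p t * sin t\<bar>)"
      by (simp add: f_def norm_mult abs_mult)
    also have "\<dots> \<le> norm (g N) * (1 / fact N * C)"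
      by (intro mult_left_mono mult_mono v C t) auto
    finally show "norm (f N t) \<le> M N * C" by (simp add: M_def)
  next
    fix t
    have "((\<lambda>N. g N * of_real (v N t) * of_real (p t * sin t)) has_sum (V t * of_real (p t * sin t))) UNIV"
      using V[of t] unfolding g_def v_def by (rule has_sum_cmult_left)
    then show "((\<lambda>N. f N t) has_sum (V t * of_real (p t * sin t))) UNIV"
      by (simp add: f_def mult_ac)
  next
    show "(\<lambda>N. M N * C) summable_on UNIV" by (rule summable_on_cmult_left[OF M])
  qed
  then obtain I J where I: "\<And>X. ((\<lambda>t. \<Sum>N\<in>X. f N t) has_integral I X) {0..pi}"
    and J: "((\<lambda>t. V t * of_real (p t * sin t)) has_integral J) {0..pi}"
    and IJ: "(I \<longlongrightarrow> J) (finite_subsets_at_top UNIV)"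
  proof (rule uniform_limit_integral)
    show "continuous_on {0..pi} (\<lambda>t. \<Sum>N\<in>X. f N t)" for X
      unfolding f_def v_def sphere_term_def p_def by (intro continuous_intros) auto
  qed auto
  have I_eq: "I X = (\<Sum>N\<in>X. g N * of_real (sphere_eigenvalue n m N) * of_real (p t'))" if "finite X" for X
  proof (rule has_integral_unique[OF I])
    show "((\<lambda>t. \<Sum>N\<in>X. f N t) has_integral (\<Sum>N\<in>X. g N * of_real (sphere_eigenvalue n m N) * of_real (p t'))) {0..pi}"
    proof (intro has_integral_sum that)
      fix N
      have "((\<lambda>t. g N * of_real (v N t * p t * sin t)) has_integral
          (g N * of_real (sphere_eigenvalue n m N * p t'))) {0..pi}"
        using has_integral_mult_right[OF has_integral_linear[OF funk_hecke_monomial[OF mn, of N t']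
            bounded_linear_of_real[where 'a = complex]], of "g N"]
        unfolding v_def p_def o_def .
      then show "(f N has_integral g N * of_real (sphere_eigenvalue n m N) * of_real (p t')) {0..pi}"
        unfolding f_def by (simp add: mult_ac)
    qed
  qed
  have "((\<lambda>N. g N * of_real (sphere_eigenvalue n m N) * of_real (p t')) has_sum J) UNIV"
    unfolding has_sum_def
    by (rule Lim_transform_eventually[OF IJ])
       (auto simp: eventually_finite_subsets_at_top I_eq intro!: exI[of _ "{}"])
  with that J show ?thesis unfolding g_def p_def by blast
qed

text \<open>Only the indices N = n - m + 2 j contribute, and for them m + N = n + 2 j, which gives
  the series of a Q function of degree n.\<close>

lemma sphere_eigenvalue_sum:
  fixes a :: complex
  assumes mn: "m \<le> n"
    and S: "((\<lambda>N. Gamma (a + of_nat m + of_nat N) * of_real z powr (- (a + of_nat m + of_nat N))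
        * of_real (sphere_eigenvalue n m N) * C) has_sum J) UNIV"
  shows "(\<lambda>j. C * of_real (sqrt pi / 2 ^ n) * (Gamma (a + of_nat n + of_nat (2 * j))
     * rGamma (of_nat n + 3 / 2 + of_nat j) / (fact j * 4 ^ j)
     * of_real z powr (- (a + of_nat n + of_nat (2 * j))))) sums J"
proof -
  let ?f = "\<lambda>N. Gamma (a + of_nat m + of_nat N) * of_real z powr (- (a + of_nat m + of_nat N))
        * of_real (sphere_eigenvalue n m N) * C"
  let ?i = "\<lambda>j. n - m + 2 * j"
  have "(?f has_sum J) (range ?i)"
  proof -
    have "sphere_eigenvalue n m N = 0" if "N \<notin> range ?i" for N
    proof (rule sphere_eigenvalue_eq_0[OF mn], rule ccontr)
      assume "\<not> (N < n - m \<or> odd (N - (n - m)))"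
      then obtain j where "N - (n - m) = 2 * j" "n - m \<le> N" by (meson evenE not_less)
      then have "N = ?i j" by simp
      with that show False by blast
    qed
    then have "(?f has_sum J) (range ?i) \<longleftrightarrow> (?f has_sum J) UNIV"
      by (intro has_sum_cong_neutral) auto
    with S show ?thesis by blast
  qed
  then have "((?f \<circ> ?i) has_sum J) UNIV"
    by (subst (asm) has_sum_reindex) (auto simp: inj_on_def)
  then have "(?f \<circ> ?i) sums J" by (rule has_sum_imp_sums)
  also have "?f \<circ> ?i = (\<lambda>j. C * of_real (sqrt pi / 2 ^ n) * (Gamma (a + of_nat n + of_nat (2 * j))
     * rGamma (of_nat n + 3 / 2 + of_nat j) / (fact j * 4 ^ j)
     * of_real z powr (- (a + of_nat n + of_nat (2 * j)))))"
  proof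
    fix j
    have 1: "a + of_nat m + of_nat (?i j) = a + of_nat n + of_nat (2 * j)"
      using mn by (simp add: of_nat_diff)
    have 2: "rGamma (of_nat n + 3 / 2 + of_nat j) = complex_of_real (1 / Gamma (real n + 3 / 2 + real j))"
    proof -
      have "of_nat n + 3 / 2 + of_nat j = complex_of_real (real n + 3 / 2 + real j)" by simp
      then show ?thesis
        by (simp only: rGamma_inverse_Gamma Gamma_complex_of_real of_real_divide of_real_1 inverse_eq_divide)
    qed
    show "(?f \<circ> ?i) j = C * of_real (sqrt pi / 2 ^ n) * (Gamma (a + of_nat n + of_nat (2 * j))
     * rGamma (of_nat n + 3 / 2 + of_nat j) / (fact j * 4 ^ j)
     * of_real z powr (- (a + of_nat n + of_nat (2 * j))))"
      unfolding o_def 1 2 sphere_eigenvalue_eq[OF mn] by (simp add: mult_ac)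
  qed
  finally show ?thesis .
qed

section \<open>Recognising both series as Legendre functions of the second kind\<close>

lemma powr_power2_half:
  assumes "y > 0"
  shows "complex_of_real (y\<^sup>2) powr (w / 2) = of_real y powr w"
  using assms powr_of_real_mult[of y y "w / 2"] by (simp add: power2_eq_square flip: powr_add)

text \<open>For degree m - 1/2 and order s - 1/2 the parameters in \<open>LegendreQ_eq\<close>
  become s + m and m + 1, so its series at A/B is the column series rescaled by powers of B. The
  prefactor cancels the power of (A/B)^2 - 1 contained in Q.\<close>

lemma LegendreQ_half_integer_eq:
  fixes s :: complex
  assumes a: "s + of_nat m \<notin> \<int>\<^sub>\<le>\<^sub>0" and AB: "0 < B" "B < A"
    and V: "(\<lambda>j. Gamma (s + of_nat m + of_nat (2 * j))
         * of_real ((B / 2) ^ (m + 2 * j) / (fact j * fact (m + j)))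
         * of_real A powr (- (s + of_nat m + of_nat (2 * j)))) sums V"
  shows "of_real ((A / B)\<^sup>2 - 1) powr ((1 - 2 * s) / 4) * LegendreQ (s - 1 / 2) (of_nat m - 1 / 2) (of_real (A / B))
     = exp ((s - 1 / 2) * of_real pi * \<i>) * of_real (sqrt pi) / 2 powr (1 / 2) * of_real B powr s * V"
proof -
  have x: "A / B > 1" using AB by simp
  have a': "of_nat m - 1 / 2 + (s - 1 / 2) + 1 = s + of_nat m" by simp
  have "(\<lambda>j. of_real B powr s * 2 ^ m * (Gamma (s + of_nat m + of_nat (2 * j))
         * of_real ((B / 2) ^ (m + 2 * j) / (fact j * fact (m + j)))
         * of_real A powr (- (s + of_nat m + of_nat (2 * j))))) sums (of_real B powr s * 2 ^ m * V)"
    by (rule sums_mult[OF V])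
  also have "(\<lambda>j. of_real B powr s * 2 ^ m * (Gamma (s + of_nat m + of_nat (2 * j))
         * of_real ((B / 2) ^ (m + 2 * j) / (fact j * fact (m + j)))
         * of_real A powr (- (s + of_nat m + of_nat (2 * j))))) =
      (\<lambda>j. Gamma (s + of_nat m + of_nat (2 * j)) * rGamma (of_nat m - 1 / 2 + 3 / 2 + of_nat j)
         / (fact j * 4 ^ j) * of_real (A / B) powr (- (s + of_nat m + of_nat (2 * j))))"
  proof
    fix j
    let ?b = "s + of_nat m + of_nat (2 * j) :: complex"
    have G: "rGamma (of_nat m - 1 / 2 + 3 / 2 + of_nat j) = (1 / fact (m + j) :: complex)"
    proof -
      have "of_nat m - 1 / 2 + 3 / 2 + of_nat j = (1 + of_nat (m + j) :: complex)" by simp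
      then show ?thesis
        by (simp only: rGamma_inverse_Gamma Gamma_fact divide_inverse mult_1_left)
    qed
    have "of_real A powr (- ?b) = of_real (A / B) powr (- ?b) * of_real B powr (- ?b)"
      using powr_of_real_mult[of "A / B" B "- ?b"] AB by simp
    also have "of_real B powr (- ?b) = of_real B powr (- s) / of_real B ^ (m + 2 * j)"
      using powr_of_real_minus_add_nat[OF AB(1), of s "m + 2 * j"] by (simp add: add_ac)
    finally have A: "of_real A powr (- ?b)
        = of_real (A / B) powr (- ?b) * (of_real B powr (- s) / of_real B ^ (m + 2 * j))" .
    have B: "of_real B powr s * of_real B powr (- s) = (1 :: complex)"
      using AB(1) by (simp add: powr_minus)
    have "of_real B powr s * 2 ^ m * (Gamma ?b
         * of_real ((B / 2) ^ (m + 2 * j) / (fact j * fact (m + j))) * of_real A powr (- ?b))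
       = (of_real B powr s * of_real B powr (- s)) * (Gamma ?b * (1 / fact (m + j))
         / (fact j * 4 ^ j) * of_real (A / B) powr (- ?b))"
    proof -
      have "(2 :: complex) ^ (2 * j) = 4 ^ j" by (simp add: power_mult)
      then have c: "2 ^ m * of_real ((B / 2) ^ (m + 2 * j) / (fact j * fact (m + j))) / of_real B ^ (m + 2 * j)
          = (1 / fact (m + j) / (fact j * 4 ^ j) :: complex)"
        using AB(1) by (simp add: power_divide power_add)
      have "b * t * (g * c * (x * (b' / d))) = (b * b') * (g * (t * c / d) * x)"
        for b t g c x b' d :: complex by simp
      then show ?thesis unfolding A by (simp only: c) simp
    qed
    then show "of_real B powr s * 2 ^ m * (Gamma ?b
         * of_real ((B / 2) ^ (m + 2 * j) / (fact j * fact (m + j))) * of_real A powr (- ?b))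
       = Gamma ?b * rGamma (of_nat m - 1 / 2 + 3 / 2 + of_nat j)
         / (fact j * 4 ^ j) * of_real (A / B) powr (- ?b)"
      unfolding G B by simp
  qed
  finally have "LegendreQ (s - 1 / 2) (of_nat m - 1 / 2) (of_real (A / B))
      = exp ((s - 1 / 2) * of_real pi * \<i>) * of_real (sqrt pi) / 2 powr (of_nat m - 1 / 2 + 1)
        * of_real ((A / B)\<^sup>2 - 1) powr ((s - 1 / 2) / 2) * (of_real B powr s * 2 ^ m * V)"
    using LegendreQ_eq[OF x, of "of_nat m - 1 / 2" "s - 1 / 2", unfolded a', OF a] by blast
  moreover have "2 powr (of_nat m - 1 / 2 + 1) = 2 ^ m * (2 powr (1 / 2) :: complex)"
  proof -
    have "of_nat m - 1 / 2 + 1 = of_nat m + (1 / 2 :: complex)" by simp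
    then show ?thesis by (simp only: powr_add) (simp add: powr_nat')
  qed
  moreover have "of_real ((A / B)\<^sup>2 - 1) powr ((1 - 2 * s) / 4) * of_real ((A / B)\<^sup>2 - 1) powr ((s - 1 / 2) / 2)
      = (1 :: complex)"
  proof -
    have "of_real w powr ((1 - 2 * s) / 4) * of_real w powr ((s - 1 / 2) / 2) = (1 :: complex)"
      if "w \<noteq> 0" for w :: real
    proof -
      have "(1 - 2 * s) / 4 + (s - 1 / 2) / 2 = 0" by (simp add: field_simps)
      with that show ?thesis by (simp flip: powr_add)
    qed
    moreover have "(A / B)\<^sup>2 - 1 \<noteq> 0" using one_less_power[OF x, of 2] by simp
    ultimately show ?thesis .
  qed
  moreover have "c * (E / (t * h) * d * (b * t * v)) = E / h * b * v" if "c * d = 1" "t \<noteq> 0"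
    for c E t h d b v :: complex
  proof -
    have "c * (E / (t * h) * d * (b * t * v)) = (c * d) * (E / h * b * v)" using that(2) by simp
    with that(1) show ?thesis by simp
  qed
  ultimately show ?thesis by (simp only: power_not_zero zero_neq_numeral[symmetric] not_False_eq_True)
qed

text \<open>Here Q has degree n and order s - 1. By the relation between z and q, its power of z^2 -
  1 equals (q/2)^(s - 1), which cancels q^(1 - s) up to a power of 2.\<close>

lemma LegendreQ_Funk_Hecke:
  fixes s C :: complex
  assumes mn: "m \<le> n" and a: "s + of_nat m \<notin> \<int>\<^sub>\<le>\<^sub>0" and q: "q > 0" "z > 1" "z\<^sup>2 - 1 = (q / 2)\<^sup>2"
    and J: "((\<lambda>N. Gamma (s + of_nat m + of_nat N) * of_real z powr (- (s + of_nat m + of_nat N))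
        * of_real (sphere_eigenvalue n m N) * C) has_sum J) UNIV"
  shows "\<i> * of_real (sqrt pi) / 2 powr (1 / 2 - s) * of_real q powr (1 - s)
      * LegendreQ (s - 1) (of_nat n) (of_real z) * C
     = exp ((s - 1 / 2) * of_real pi * \<i>) * of_real (sqrt pi) / 2 powr (1 / 2) * J"
\<comment> \<open>In the application \<open>C\<close> contains the Ferrers polynomial at cos
  \<theta>' and may vanish. The series for Q is obtained by dividing by it; for C = 0 both sides are
  zero.\<close>
proof (cases "C = 0")
  case True
  then have "((\<lambda>_ :: nat. 0) has_sum J) UNIV" using J by simp
  then have "J = 0" by (rule has_sum_unique) (rule has_sum_0, simp)
  with True show ?thesis by simp
next
  case False
  define K where "K = C * complex_of_real (sqrt pi / 2 ^ n)"
  have K: "K \<noteq> 0" using False by (simp add: K_def)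
  have a': "of_nat n + (s - 1) + 1 = s + of_nat n" by simp
  have an: "s + of_nat n \<notin> \<int>\<^sub>\<le>\<^sub>0"
    using add_nat_notin_nonpos_Ints[OF a, of "n - m"] mn by (simp add: of_nat_diff)
  have "(\<lambda>j. K * (Gamma (s + of_nat n + of_nat (2 * j)) * rGamma (of_nat n + 3 / 2 + of_nat j)
      / (fact j * 4 ^ j) * of_real z powr (- (s + of_nat n + of_nat (2 * j))))) sums (K * (J / K))"
    using sphere_eigenvalue_sum[OF mn J] K unfolding K_def[symmetric] by simp
  then have "(\<lambda>j. Gamma (s + of_nat n + of_nat (2 * j)) * rGamma (of_nat n + 3 / 2 + of_nat j)
      / (fact j * 4 ^ j) * of_real z powr (- (s + of_nat n + of_nat (2 * j)))) sums (J / K)"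
    by (subst (asm) sums_mult_iff[OF K])
  then have Q: "LegendreQ (s - 1) (of_nat n) (of_real z)
      = exp ((s - 1) * of_real pi * \<i>) * of_real (sqrt pi) / 2 powr (of_nat n + 1)
        * of_real (z\<^sup>2 - 1) powr ((s - 1) / 2) * (J / K)"
    using LegendreQ_eq[OF q(2), of "of_nat n" "s - 1", unfolded a', OF an] by blast
  have q': "of_real q powr (1 - s) * of_real (z\<^sup>2 - 1) powr ((s - 1) / 2) = (2 powr (1 - s) :: complex)"
  proof -
    have "complex_of_real q powr (1 - s) = of_real (q / 2) powr (1 - s) * 2 powr (1 - s)"
      using powr_of_real_mult[of "q / 2" 2 "1 - s"] q(1) by simp
    moreover have "complex_of_real (z\<^sup>2 - 1) powr ((s - 1) / 2) = of_real (q / 2) powr (s - 1)"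
      unfolding q(3) using q(1) by (intro powr_power2_half) simp
    moreover have "of_real (q / 2) powr (1 - s) * of_real (q / 2) powr (s - 1) = (1 :: complex)"
      using q(1) by (simp flip: powr_add)
    ultimately show ?thesis by (metis mult.assoc mult.commute mult.left_neutral)
  qed
  have two: "2 powr (1 - s) = 2 powr (1 / 2 - s) * (2 powr (1 / 2) :: complex)"
    by (simp flip: powr_add)
  have n: "2 powr (of_nat n + 1) = (2 ^ n * 2 :: complex)"
    by (simp add: powr_add powr_nat')
  have half: "2 powr (1 / 2) * 2 powr (1 / 2) = (2 :: complex)"
    by (simp flip: powr_add)
  \<comment> \<open>The orders s - 1/2 and s - 1 differ by 1/2, so the phases differ by exp(i pi/2);
    this is the factor i on the right of the theorem.\<close>
  have "exp ((s - 1 / 2) * of_real pi * \<i>) = exp ((s - 1) * of_real pi * \<i> + \<i> * (of_real pi / 2))"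
    by (simp add: algebra_simps)
  also have "\<dots> = exp ((s - 1) * of_real pi * \<i>) * \<i>"
    using cis_conv_exp[of "pi / 2"] by (simp add: exp_add)
  finally have e: "exp ((s - 1 / 2) * of_real pi * \<i>) = exp ((s - 1) * of_real pi * \<i>) * \<i>" .
  let ?E = "exp ((s - 1) * of_real pi * \<i>) :: complex" and ?T = "2 powr (1 / 2) :: complex"
  have "\<i> * of_real (sqrt pi) / 2 powr (1 / 2 - s) * of_real q powr (1 - s)
      * LegendreQ (s - 1) (of_nat n) (of_real z) * C
    = \<i> * of_real (sqrt pi) / 2 powr (1 / 2 - s) * (of_real q powr (1 - s) * of_real (z\<^sup>2 - 1) powr ((s - 1) / 2))
      * (?E * of_real (sqrt pi) / (2 ^ n * 2) * (J / K)) * C"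
    unfolding Q n by simp
  also have "\<dots> = \<i> * ?E * of_real (sqrt pi) * of_real (sqrt pi) * (?T / 2) * (J / K) * C / 2 ^ n"
  proof -
    have identity: "i * w / P * (P * T) * (E * w / (N * 2) * X) * C = i * E * w * w * (T / 2) * X * C / N"
      if "P \<noteq> 0" for i w P T E N X C :: complex
      using that by (simp add: field_simps)
    show ?thesis unfolding q' two by (rule identity) simp
  qed
  also have "?T / 2 = 1 / ?T"
    using half by (simp add: field_simps)
  also have "\<i> * ?E * of_real (sqrt pi) * of_real (sqrt pi) * (1 / ?T) * (J / K) * C / 2 ^ n
      = (?E * \<i>) * of_real (sqrt pi) / ?T * J"
    using False by (simp add: K_def)
  finally show ?thesis unfolding e .
qed

theorem theorem3p1:
  fixes n m :: nat and \<nu> :: complex and r r' \<theta>' :: real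
  assumes "m \<le> n"
    and "\<forall>k::nat. \<nu> \<noteq> of_nat (2 * m + 2 * k)"
    and "0 < r" and "0 < r'" and "r \<noteq> r'"
    and "0 < \<theta>'" and "\<theta>' < pi"
  shows "((\<lambda>\<theta>. let chi = (r\<^sup>2 + r'\<^sup>2 - 2 * r * r' * cos \<theta> * cos \<theta>')
                         / (2 * r * r' * sin \<theta> * sin \<theta>')
            in complex_of_real (chi\<^sup>2 - 1) powr ((\<nu> + 1) / 4)
               * LegendreQ (- (\<nu> + 1) / 2) (of_nat m - 1 / 2) (complex_of_real chi)
               * FerrersP (of_nat m) (of_nat n) (cos \<theta>)
               * complex_of_real (sin \<theta>) powr ((\<nu> + 2) / 2))
         has_integral
          (\<i> * of_real (sqrt pi)
             / (2 powr ((\<nu> + 1) / 2) * complex_of_real (sin \<theta>') powr (\<nu> / 2))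
             * complex_of_real (((max r r')\<^sup>2 - (min r r')\<^sup>2) / (r * r')) powr ((\<nu> + 2) / 2)
             * LegendreQ (- (\<nu> + 2) / 2) (of_nat n)
                 (complex_of_real ((r\<^sup>2 + r'\<^sup>2) / (2 * r * r')))
             * FerrersP (of_nat m) (of_nat n) (cos \<theta>'))) {0..pi}"
proof -
  define s where "s = - \<nu> / 2"
  define z where "z = (r\<^sup>2 + r'\<^sup>2) / (2 * r * r')"
  define q where "q = ((max r r')\<^sup>2 - (min r r')\<^sup>2) / (r * r')"
  define p where "p = ferrers_poly n m"
  define \<kappa> where "\<kappa> = exp ((s - 1 / 2) * of_real pi * \<i>) * of_real (sqrt pi) / 2 powr (1 / 2)"
  \<comment> \<open>The excluded values of \<nu> are exactly those for which Gamma(s + m) has a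
    pole.\<close>
  have a: "s + of_nat m \<notin> \<int>\<^sub>\<le>\<^sub>0"
  proof
    assume "s + of_nat m \<in> \<int>\<^sub>\<le>\<^sub>0"
    then obtain k where "s + of_nat m = - of_nat k" by (auto elim: nonpos_Ints_cases')
    then have "s = - of_nat k - of_nat m" by (simp add: eq_diff_eq)
    then have "\<nu> = of_nat (2 * m + 2 * k)" by (simp add: s_def field_simps)
    with assms(2) show False by blast
  qed
  have rr: "r * r' > 0" using assms by simp
  have z1: "z > 1"
  proof -
    have "(r - r')\<^sup>2 > 0" using assms by simp
    then show ?thesis using rr by (simp add: z_def power2_eq_square algebra_simps)
  qed
  have q0: "q > 0"
  proof -
    have "(min r r')\<^sup>2 < (max r r')\<^sup>2" using assms by (intro power_strict_mono) (auto simp: min_def max_def)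
    then show ?thesis using rr by (simp add: q_def)
  qed
  \<comment> \<open>Thus q/2 is the positive square root of z^2 - 1; squaring removes the
    distinction between maximum and minimum.\<close>
  have zq: "z\<^sup>2 - 1 = (q / 2)\<^sup>2"
  proof -
    have "((max r r')\<^sup>2 - (min r r')\<^sup>2)\<^sup>2 = (r\<^sup>2 - r'\<^sup>2)\<^sup>2"
      by (auto simp: max_def min_def power2_commute)
    then have "(q / 2)\<^sup>2 = (r\<^sup>2 - r'\<^sup>2)\<^sup>2 / (2 * r * r')\<^sup>2"
      by (simp add: q_def power_divide power_mult_distrib)
    also have "(r\<^sup>2 - r'\<^sup>2)\<^sup>2 = (r\<^sup>2 + r'\<^sup>2)\<^sup>2 - (2 * r * r')\<^sup>2"
      by (simp add: power2_eq_square algebra_simps)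
    also have "\<dots> / (2 * r * r')\<^sup>2 = z\<^sup>2 - 1"
    proof -
      have "(2 * r * r')\<^sup>2 \<noteq> 0" using rr by auto
      from divide_self[OF this] show ?thesis by (simp only: z_def power_divide diff_divide_distrib)
    qed
    finally show ?thesis ..
  qed
  have s': "sin \<theta>' > 0" using assms by (intro sin_gt_zero) auto
  \<comment> \<open>One value V t serves both series: the first is integrated termwise, the second
    identifies V t with the Q function in the integrand.\<close>
  have "\<forall>t. \<exists>V. ((\<lambda>N. Gamma (s + of_nat m + of_nat N) * of_real z powr (- (s + of_nat m + of_nat N))
         * of_real (\<Sum>j\<le>N div 2. sphere_term m N j (cos t * cos \<theta>') (sin t * sin \<theta>'))) has_sum V) UNIV \<and>
    (\<lambda>j. Gamma (s + of_nat m + of_nat (2 * j)) * of_real ((sin t * sin \<theta>' / 2) ^ (m + 2 * j) / (fact j * fact (m + j)))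
         * of_real (z - cos t * cos \<theta>') powr (- (s + of_nat m + of_nat (2 * j)))) sums V"
    using sphere_series[OF a z1 abs_cos_sin_product_le, where m = m] by blast
  from choice[OF this] obtain V where V1: "\<And>t. ((\<lambda>N. Gamma (s + of_nat m + of_nat N) * of_real z powr (- (s + of_nat m + of_nat N))
         * of_real (\<Sum>j\<le>N div 2. sphere_term m N j (cos t * cos \<theta>') (sin t * sin \<theta>'))) has_sum V t) UNIV"
    and V2: "\<And>t. (\<lambda>j. Gamma (s + of_nat m + of_nat (2 * j)) * of_real ((sin t * sin \<theta>' / 2) ^ (m + 2 * j) / (fact j * fact (m + j)))
         * of_real (z - cos t * cos \<theta>') powr (- (s + of_nat m + of_nat (2 * j)))) sums V t"
    by blast
  obtain J where
    J1: "((\<lambda>N. Gamma (s + of_nat m + of_nat N) * of_real z powr (- (s + of_nat m + of_nat N))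
        * of_real (sphere_eigenvalue n m N) * of_real (sin \<theta>' ^ m * poly p (cos \<theta>'))) has_sum J) UNIV"
    and J2: "((\<lambda>t. V t * of_real (sin t ^ m * poly p (cos t) * sin t)) has_integral J) {0..pi}"
    using funk_hecke_kernel[OF a z1 assms(1) V1] unfolding p_def by blast
  \<comment> \<open>The endpoints are excluded because sin t = 0 there makes chi a quotient by zero;
    two points do not affect the integral.\<close>
  have integrand: "(let chi = (r\<^sup>2 + r'\<^sup>2 - 2 * r * r' * cos t * cos \<theta>') / (2 * r * r' * sin t * sin \<theta>')
            in complex_of_real (chi\<^sup>2 - 1) powr ((\<nu> + 1) / 4)
               * LegendreQ (- (\<nu> + 1) / 2) (of_nat m - 1 / 2) (complex_of_real chi)
               * FerrersP (of_nat m) (of_nat n) (cos t)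
               * complex_of_real (sin t) powr ((\<nu> + 2) / 2))
      = \<kappa> * of_real (sin \<theta>') powr s / 2 ^ m * (V t * of_real (sin t ^ m * poly p (cos t) * sin t))"
    if t: "t \<in> {0..pi} - {0, pi}" for t
  proof -
    have t0: "0 < t" "t < pi" using t by auto
    have st: "sin t > 0" using t0 by (rule sin_gt_zero)
    define A B where "A = z - cos t * cos \<theta>'" and "B = sin t * sin \<theta>'"
    have B0: "B > 0" using st s' by (simp add: B_def)
    have BA: "B < A"
      using abs_cos_sin_product_le[of t \<theta>'] z1 unfolding A_def B_def by linarith
    have chi: "(r\<^sup>2 + r'\<^sup>2 - 2 * r * r' * cos t * cos \<theta>') / (2 * r * r' * sin t * sin \<theta>') = A / B"
      using assms st s' by (simp add: A_def B_def z_def field_simps)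
    have \<nu>: "(\<nu> + 1) / 4 = (1 - 2 * s) / 4" "- (\<nu> + 1) / 2 = s - 1 / 2" "(\<nu> + 2) / 2 = 1 - s"
      by (simp_all add: s_def field_simps)
    \<comment> \<open>The weight (sin t)^(1 - s) and the factor (sin t)^s in B^s leave the single
      sin t of the surface measure, while (sin \<theta>')^s is a constant.\<close>
    have "complex_of_real (sin t) powr s * of_real (sin t) powr (1 - s) = of_real (sin t)"
      using st by (simp flip: powr_add)
    moreover have "complex_of_real B powr s = of_real (sin t) powr s * of_real (sin \<theta>') powr s"
      unfolding B_def using st s' by (intro powr_of_real_mult)
    ultimately have sB: "complex_of_real B powr s * of_real (sin t) powr (1 - s)
        = of_real (sin \<theta>') powr s * of_real (sin t)"
      by (metis mult.assoc mult.commute)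
    have "of_real ((A / B)\<^sup>2 - 1) powr ((1 - 2 * s) / 4)
        * LegendreQ (s - 1 / 2) (of_nat m - 1 / 2) (of_real (A / B)) = \<kappa> * of_real B powr s * V t"
      unfolding \<kappa>_def using LegendreQ_half_integer_eq[OF a B0 BA V2[of t, folded A_def B_def]] .
    moreover have "FerrersP (of_nat m) (of_nat n) (cos t) = of_real (sin t ^ m * poly p (cos t)) / 2 ^ m"
      using FerrersP_eq[OF t0, of m n] by (simp add: p_def)
    ultimately have "of_real ((A / B)\<^sup>2 - 1) powr ((1 - 2 * s) / 4)
        * LegendreQ (s - 1 / 2) (of_nat m - 1 / 2) (of_real (A / B))
        * FerrersP (of_nat m) (of_nat n) (cos t) * of_real (sin t) powr (1 - s)
      = \<kappa> * V t * (of_real (sin t ^ m * poly p (cos t)) / 2 ^ m) * (of_real B powr s * of_real (sin t) powr (1 - s))"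
      by simp
    also have "\<dots> = \<kappa> * of_real (sin \<theta>') powr s / 2 ^ m * (V t * of_real (sin t ^ m * poly p (cos t) * sin t))"
      unfolding sB by simp
    finally show ?thesis unfolding chi Let_def \<nu> .
  qed
  have "((\<lambda>t. \<kappa> * of_real (sin \<theta>') powr s / 2 ^ m * (V t * of_real (sin t ^ m * poly p (cos t) * sin t)))
      has_integral (\<kappa> * of_real (sin \<theta>') powr s / 2 ^ m * J)) {0..pi}"
    by (rule has_integral_mult_right[OF J2])
  moreover have "\<kappa> * of_real (sin \<theta>') powr s / 2 ^ m * J
    = \<i> * of_real (sqrt pi) / (2 powr ((\<nu> + 1) / 2) * complex_of_real (sin \<theta>') powr (\<nu> / 2))
       * complex_of_real q powr ((\<nu> + 2) / 2) * LegendreQ (- (\<nu> + 2) / 2) (of_nat n) (complex_of_real z)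
       * FerrersP (of_nat m) (of_nat n) (cos \<theta>')"
  proof -
    have \<nu>: "(\<nu> + 1) / 2 = 1 / 2 - s" "- (\<nu> + 2) / 2 = s - 1" "(\<nu> + 2) / 2 = 1 - s" "\<nu> / 2 = - s"
      by (simp_all add: s_def field_simps)
    have P: "FerrersP (of_nat m) (of_nat n) (cos \<theta>') = of_real (sin \<theta>' ^ m * poly p (cos \<theta>')) / 2 ^ m"
      using FerrersP_eq[OF assms(6,7), of m n] by (simp add: p_def)
    have "\<kappa> * J = \<i> * of_real (sqrt pi) / 2 powr (1 / 2 - s) * of_real q powr (1 - s)
        * LegendreQ (s - 1) (of_nat n) (of_real z) * of_real (sin \<theta>' ^ m * poly p (cos \<theta>'))"
      unfolding \<kappa>_def using LegendreQ_Funk_Hecke[OF assms(1) a q0 z1 zq J1] by simp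
    then have "\<kappa> * of_real (sin \<theta>') powr s / 2 ^ m * J = of_real (sin \<theta>') powr s / 2 ^ m
       * (\<i> * of_real (sqrt pi) / 2 powr (1 / 2 - s) * of_real q powr (1 - s)
        * LegendreQ (s - 1) (of_nat n) (of_real z) * of_real (sin \<theta>' ^ m * poly p (cos \<theta>')))"
      by (metis mult.assoc mult.commute times_divide_eq_right)
    then show ?thesis
      unfolding \<nu> P using s' by (simp add: powr_minus field_simps)
  qed
  ultimately show ?thesis
    unfolding q_def[symmetric] z_def[symmetric]
    by (intro has_integral_spike_finite[of "{0, pi}", OF _ integrand]) simp_all
qed

end
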